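(* If $H$ is a cloud-forest graph, and $p=p(n)$ satisfies $p=o(1)$ and $p=n^{-o(1)}$, then $$\delta_\chi(H,p)\le\frac13.$$
   Context: $G(n,p)$ denotes the binomial random graph on $n$ vertices, and "with high probability" means with probability tending to $1$ as $n \to \infty$. A graph is $H$-free if it contains no (not necessarily induced) subgraph isomorphic to $H$; $\delta(G)$ denotes the minimum degree and $\chi(G)$ the chromatic number of $G$. The condition $p=n^{-o(1)}$ means $\log(1/p(n))/\log n\to 0$. Given a graph $H$ and a function $p=p(n)\in[0,1]$, $\delta_\chi(H,p)$ is the infimum over $d>0$ such that there exists $C>0$ for which the following holds with high probability: every $H$-free spanning subgraph $G\subseteq G(n,p)$ with $\delta(G)\ge dpn$ satisfies $\chi(G)\le C$. Here $C$ may depend on $H$, on the function $p$ and on $d$, but not on $n$. A graph $H$ is a cloud-forest graph if there is an independent set $I\subseteq V(H)$ (the cloud) such that $V(H)\setminus I$ induces a forest $F$, the only edges from $I$ to $F$ go to leaves or isolated vertices of $F$, and no two adjacent leaves in $F$ (both) send edges to $I$. Equivalently, $V(H)$ can be partitioned into independent sets $I$ and $J$ and a set inducing a forest $F'$, such that there are no edges from $V(F')$ to $I$ and each vertex of $J$ has at most one neighbour in $V(F')$. *)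

theory Defs
  imports
    "Graph_Theory.Pair_Digraph"
    "Graph_Theory.Digraph_Component"
    "Graph_Theory.Digraph_Isomorphism"
    "HOL-Probability.Product_PMF"
begin

text \<open>
  A finite simple graph is a \<^locale>\<open>pair_graph\<close>: each undirected edge \<open>uv\<close> is represented
  by the two arcs \<open>(u, v)\<close> and \<open>(v, u)\<close>, so the degree of a vertex is its \<^const>\<open>out_degree\<close>.
\<close>

definition independent_set :: "'a pair_pre_digraph \<Rightarrow> 'a set \<Rightarrow> bool" where
  "independent_set G I \<longleftrightarrow> I \<subseteq> pverts G \<and> (\<forall>u\<in>I. \<forall>v\<in>I. (u, v) \<notin> parcs G)"

definition min_degree :: "'a pair_pre_digraph \<Rightarrow> nat" where
  "min_degree G = Min (out_degree G ` pverts G)"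

definition proper_coloring :: "'a pair_pre_digraph \<Rightarrow> nat \<Rightarrow> ('a \<Rightarrow> nat) \<Rightarrow> bool" where
  "proper_coloring G k c \<longleftrightarrow>
     (\<forall>v\<in>pverts G. c v < k) \<and> (\<forall>(u, v)\<in>parcs G. c u \<noteq> c v)"

definition chromatic_number :: "'a pair_pre_digraph \<Rightarrow> nat" where
  "chromatic_number G = (LEAST k. \<exists>c. proper_coloring G k c)"

text \<open>Subgraphs need not be induced.\<close>

definition subgraph_free :: "'a pair_pre_digraph \<Rightarrow> 'b pair_pre_digraph \<Rightarrow> bool" where
  "subgraph_free H G \<longleftrightarrow>
     \<not> (\<exists>K. subgraph K (with_proj G) \<and> digraph_iso (with_proj H) K)"

text \<open>
  The closed walk \<open>u, v, u\<close> along a single edge counts as a \<^const>\<open>pre_digraph.cycle\<close>, so the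
  constant \<^const>\<open>forest\<close> does not express acyclicity of the underlying undirected graph;
  an undirected cycle has length at least 3.
\<close>

definition undirected_forest :: "('a, 'b) pre_digraph \<Rightarrow> bool" where
  "undirected_forest F \<longleftrightarrow> \<not> (\<exists>q. pre_digraph.cycle F q \<and> 3 \<le> length q)"

definition cloud_forest :: "'a pair_pre_digraph \<Rightarrow> bool" where
  "cloud_forest H \<longleftrightarrow>
     (\<exists>I. independent_set H I \<and>
        (let F = with_proj H \<restriction> (pverts H - I);
             leaf = (\<lambda>v. v \<in> verts F \<and> out_degree F v = 1);
             isolated = (\<lambda>v. v \<in> verts F \<and> out_degree F v = 0);
             sends = (\<lambda>v. \<exists>u\<in>I. (v, u) \<in> parcs H)
         in undirected_forest F \<and>
            (\<forall>v\<in>verts F. sends v \<longrightarrow> leaf v \<or> isolated v) \<and>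
            (\<forall>(v, w)\<in>arcs F. leaf v \<and> leaf w \<longrightarrow> \<not> (sends v \<and> sends w))))"

definition vertex_pairs :: "nat \<Rightarrow> nat set set" where
  "vertex_pairs n = {e. e \<subseteq> {..<n} \<and> card e = 2}"

definition binomial_random_graph :: "nat \<Rightarrow> real \<Rightarrow> nat pair_pre_digraph pmf" where
  "binomial_random_graph n q =
     map_pmf (\<lambda>X. \<lparr>pverts = {..<n}, parcs = {(u, v). {u, v} \<in> vertex_pairs n \<and> X {u, v}}\<rparr>)
       (Pi_pmf (vertex_pairs n) False (\<lambda>_. bernoulli_pmf q))"

definition with_high_probability :: "(nat \<Rightarrow> 'a pmf) \<Rightarrow> (nat \<Rightarrow> 'a \<Rightarrow> bool) \<Rightarrow> bool" where
  "with_high_probability M P \<longleftrightarrow>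
     (\<lambda>n. measure_pmf.prob (M n) {x. P n x}) \<longlonglongrightarrow> 1"

text \<open>The infimum is taken in the extended reals, so that no convention for the infimum
  of an empty set of reals is involved.\<close>

definition delta_chi :: "'a pair_pre_digraph \<Rightarrow> (nat \<Rightarrow> real) \<Rightarrow> ereal" where
  "delta_chi H p = Inf (ereal ` {d. d > 0 \<and> (\<exists>C>0::real.
     with_high_probability (\<lambda>n. binomial_random_graph n (p n))
       (\<lambda>n \<Gamma>. \<forall>G. pair_graph G \<and> spanning (with_proj G) (with_proj \<Gamma>) \<and> subgraph_free H G \<and>
              d * p n * real n \<le> real (min_degree G) \<longrightarrow>
              real (chromatic_number G) \<le> C))})"

text \<open>\<open>p = n\<^sup>-\<^sup>o\<^sup>(\<^sup>1\<^sup>)\<close>. Positivity is stated separately because \<open>ln (1 / 0) = 0\<close> here, whereas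
  \<open>log (1 / p n)\<close> is infinite if \<open>p n = 0\<close>.\<close>

definition n_to_minus_o1 :: "(nat \<Rightarrow> real) \<Rightarrow> bool" where
  "n_to_minus_o1 p \<longleftrightarrow>
     (\<forall>\<^sub>F n in sequentially. p n > 0) \<and> (\<lambda>n. ln (1 / p n) / ln (real n)) \<longlonglongrightarrow> 0"

end

theory Submission
  imports Defs
begin

text \<open>
  Let \<open>d = 1/3 + 3e\<close> and let \<open>G\<close> be an \<open>H\<close>-free spanning subgraph of minimum degree at least \<open>d p n\<close>. Write
  \<open>S v\<close> for the set of vertices with at least \<open>p\<^sup>1\<^sup>7 n\<close> common neighbours with \<open>v\<close>, and call an edge
  \<open>uv\<close> heavy if \<open>S u \<inter> S v\<close> has at least \<open>e n\<close> elements.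

  The heavy edges form a graph of bounded degeneracy: a heavy subgraph of large minimum degree
  contains any prescribed tree on vertices whose sets \<open>S v\<close> have linearly many common points. These
  points share a suitable tuple of leaves attached to the tree, and \<open>n\<^sup>1\<^sup>-\<^sup>o\<^sup>(\<^sup>1\<^sup>)\<close> of them survive, so they
  serve as the cloud and yield a copy of \<open>H\<close>.

  The remaining edges form a bipartite graph. By upper uniformity of the random graph, the set of
  vertices that are robustly adjacent to a given set of \<open>n\<^sup>1\<^sup>-\<^sup>o\<^sup>(\<^sup>1\<^sup>)\<close> vertices has more than \<open>n/3 + 2en\<close>
  elements. Hence \<open>S u \<inter> S v\<close> has more than \<open>n/3 + 2en\<close> elements as soon as \<open>u\<close> and \<open>v\<close> have many common
  neighbours, whereas it is smaller than \<open>e n\<close> for a non-heavy edge \<open>uv\<close>, and three sets of more than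
  \<open>n/3 + 2en\<close> vertices cannot be nearly disjoint. If \<open>ab\<close> is a non-heavy edge, then every \<open>S v\<close> meets
  \<open>S a\<close> or \<open>S b\<close> substantially, and the vertices of either kind are independent: a non-heavy edge inside
  one class would create a configuration of three non-heavy edges linked cyclically by pairs of
  large codegree, which is impossible.
\<close>

section \<open>Degenerate graphs and trees\<close>

text \<open>If all values stayed below \<open>c\<close>, the sum would fall below
  \<open>card A * c\<close>, hence below \<open>k * c\<close>. Only an upper bound \<open>k\<close>
  on the size is asked for, so that degrees or powers of \<open>card V\<close> can be supplied
  directly.\<close>

lemma averaging:
  fixes f :: "'a \<Rightarrow> real"
  assumes "finite A" "A \<noteq> {}" "0 \<le> c" "real (card A) \<le> k" "k * c \<le> sum f A"
  shows "\<exists>a\<in>A. c \<le> f a"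
proof (rule ccontr)
  assume "\<not> ?thesis"
  then have "sum f A < (\<Sum>a\<in>A. c)"
    using assms by (intro sum_strict_mono) auto
  also have "\<dots> \<le> k * c"
    using assms by (simp add: mult_right_mono)
  finally show False using assms by simp
qed

text \<open>An edge at \<open>v\<close> is counted twice in the degree sum, once at \<open>v\<close>
  and once at its other end, which explains the factor 2.\<close>

lemma sum_card_neighbours_remove:
  fixes N :: "'v \<Rightarrow> 'v set"
  assumes A: "finite A" "v \<in> A"
    and sym: "\<And>u w. u \<in> A \<Longrightarrow> w \<in> A \<Longrightarrow> u \<in> N w \<longleftrightarrow> w \<in> N u" and irr: "v \<notin> N v"
  shows "(\<Sum>w\<in>A. card (N w \<inter> A)) =
    (\<Sum>w\<in>A - {v}. card (N w \<inter> (A - {v}))) + 2 * card (N v \<inter> A)"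
proof -
  have "card (N w \<inter> A) = card (N w \<inter> (A - {v})) + (if w \<in> N v then 1 else 0)"
    if "w \<in> A - {v}" for w
  proof (cases "w \<in> N v")
    case True
    then have "N w \<inter> A = insert v (N w \<inter> (A - {v}))" using that A sym by auto
    then show ?thesis using True A(1) by simp
  next
    case False
    then have "N w \<inter> A = N w \<inter> (A - {v})" using that A sym by auto
    then show ?thesis using False by simp
  qed
  then have "(\<Sum>w\<in>A - {v}. card (N w \<inter> A)) =
      (\<Sum>w\<in>A - {v}. card (N w \<inter> (A - {v}))) + (\<Sum>w\<in>A - {v}. if w \<in> N v then 1 else 0)"
    by (simp add: sum.distrib)
  also have "(\<Sum>w\<in>A - {v}. if w \<in> N v then 1 else 0) = card ((A - {v}) \<inter> N v)"
    using A(1) by (simp add: sum.If_cases Int_def)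
  also have "(A - {v}) \<inter> N v = N v \<inter> A" using irr by auto
  finally show ?thesis using A by (simp add: sum.remove[of A v])
qed

text \<open>Deleting vertices of degree below \<open>D\<close> one after another destroys fewer than
  \<open>D\<close> edges each time. This bounds the number of heavy edges linearly, as the bipartite
  part requires.\<close>

lemma degenerate_sum_degrees:
  fixes N :: "'v \<Rightarrow> 'v set"
  assumes "finite V" and sym: "\<And>u v. u \<in> N v \<longleftrightarrow> v \<in> N u" and irr: "\<And>v. v \<notin> N v"
    and deg: "\<And>W. W \<subseteq> V \<Longrightarrow> W \<noteq> {} \<Longrightarrow> \<exists>v\<in>W. card (N v \<inter> W) < D"
  shows "(\<Sum>v\<in>V. card (N v \<inter> V)) \<le> 2 * D * card V"
  using assms(1) deg
proof (induction V rule: finite_psubset_induct)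
  case (psubset V)
  show ?case
  proof (cases "V = {}")
    case False
    then obtain v where v: "v \<in> V" "card (N v \<inter> V) < D" using psubset.prems by blast
    have "(\<Sum>w\<in>V - {v}. card (N w \<inter> (V - {v}))) \<le> 2 * D * card (V - {v})"
      using v by (intro psubset.IH psubset.prems) auto
    moreover have "card V = Suc (card (V - {v}))"
      using v psubset.hyps by (metis card.remove)
    moreover have "(\<Sum>w\<in>V. card (N w \<inter> V)) =
        (\<Sum>w\<in>V - {v}. card (N w \<inter> (V - {v}))) + 2 * card (N v \<inter> V)"
      using psubset.hyps v(1) sym irr by (rule sum_card_neighbours_remove)
    ultimately show ?thesis using v(2) by simp
  qed simp
qed

text \<open>Greedy colouring: a vertex of degree below \<open>D\<close> is set aside, the rest is
  coloured by induction, and its neighbours leave one of the \<open>D\<close> colours free.\<close>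

lemma degenerate_coloring:
  fixes N :: "'v \<Rightarrow> 'v set"
  assumes "finite V" and sym: "\<And>u v. u \<in> N v \<longleftrightarrow> v \<in> N u" and irr: "\<And>v. v \<notin> N v"
    and deg: "\<And>W. W \<subseteq> V \<Longrightarrow> W \<noteq> {} \<Longrightarrow> \<exists>v\<in>W. card (N v \<inter> W) < D"
  shows "\<exists>c. (\<forall>v\<in>V. c v < D) \<and> (\<forall>u\<in>V. \<forall>v\<in>V. u \<in> N v \<longrightarrow> c u \<noteq> (c v :: nat))"
  using assms(1) deg
proof (induction V rule: finite_psubset_induct)
  case (psubset V)
  show ?case
  proof (cases "V = {}")
    case False
    then obtain v where v: "v \<in> V" "card (N v \<inter> V) < D" using psubset.prems by blast
    have "\<exists>c. (\<forall>v\<in>V - {v}. c v < D) \<and>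
        (\<forall>u\<in>V - {v}. \<forall>w\<in>V - {v}. u \<in> N w \<longrightarrow> c u \<noteq> (c w :: nat))"
      using v by (intro psubset.IH psubset.prems) auto
    then obtain c where c: "\<forall>v\<in>V - {v}. c v < D"
        "\<forall>u\<in>V - {v}. \<forall>w\<in>V - {v}. u \<in> N w \<longrightarrow> c u \<noteq> (c w :: nat)" by blast
    have "card (c ` (N v \<inter> V)) \<le> card (N v \<inter> V)"
      using psubset.hyps by (intro card_image_le) auto
    then have "\<not> {..<D} \<subseteq> c ` (N v \<inter> V)"
      using v psubset.hyps card_mono[of "c ` (N v \<inter> V)" "{..<D}"] by auto
    then obtain k where k: "k < D" "k \<notin> c ` (N v \<inter> V)" by auto
    have "(\<forall>w\<in>V. (c(v := k)) w < D) \<and>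
        (\<forall>u\<in>V. \<forall>w\<in>V. u \<in> N w \<longrightarrow> (c(v := k)) u \<noteq> (c(v := k)) w)"
    proof (intro conjI ballI impI)
      fix w assume "w \<in> V"
      then show "(c(v := k)) w < D" using c(1) k(1) by auto
    next
      fix u w assume uw: "u \<in> V" "w \<in> V" "u \<in> N w"
      have ne: "c x \<noteq> k" if "x \<in> V" "x \<in> N v" for x using k(2) that by auto
      consider "u = v" "w \<noteq> v" | "w = v" "u \<noteq> v" | "u \<noteq> v" "w \<noteq> v"
        using irr uw(3) by blast
      then show "(c(v := k)) u \<noteq> (c(v := k)) w"
      proof cases
        case 1
        then show ?thesis using ne[of w] uw sym by auto
      next
        case 2
        then show ?thesis using ne[of u] uw by auto
      next
        case 3
        then show ?thesis using c(2) uw by auto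
      qed
    qed
    then show ?thesis by blast
  qed simp
qed

text \<open>As long as some vertex violates its own bound \<open>b v\<close>, delete it; the degree
  sum drops by less than \<open>2 * b v\<close>, so the total loss is at most
  \<open>2 * sum b A\<close>. The bound varies with the vertex so that it can be a proportion of a
  degree.\<close>

lemma dense_core:
  fixes N :: "'v \<Rightarrow> 'v set" and b :: "'v \<Rightarrow> real"
  assumes "finite A" and b: "\<And>v. 0 \<le> b v"
    and sym: "\<And>u w. u \<in> A \<Longrightarrow> w \<in> A \<Longrightarrow> u \<in> N w \<longleftrightarrow> w \<in> N u" and irr: "\<And>v. v \<notin> N v"
  shows "\<exists>U\<subseteq>A. (\<forall>v\<in>U. b v \<le> card (N v \<inter> U)) \<and>
    real (\<Sum>v\<in>A. card (N v \<inter> A)) - 2 * sum b A \<le> real (\<Sum>v\<in>U. card (N v \<inter> U))"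
  using assms(1) sym
proof (induction A rule: finite_psubset_induct)
  case (psubset A)
  show ?case
  proof (cases "\<forall>v\<in>A. b v \<le> card (N v \<inter> A)")
    case True
    then show ?thesis using sum_nonneg[of A b] b by (intro exI[of _ A]) auto
  next
    case False
    then obtain v where v: "v \<in> A" "card (N v \<inter> A) < b v" by auto
    have "\<exists>U\<subseteq>A - {v}. (\<forall>v\<in>U. b v \<le> card (N v \<inter> U)) \<and>
        real (\<Sum>w\<in>A - {v}. card (N w \<inter> (A - {v}))) - 2 * sum b (A - {v})
          \<le> real (\<Sum>v\<in>U. card (N v \<inter> U))"
      using v psubset.prems by (intro psubset.IH) auto
    then obtain U where U: "U \<subseteq> A - {v}" "\<forall>v\<in>U. b v \<le> card (N v \<inter> U)"
        "real (\<Sum>w\<in>A - {v}. card (N w \<inter> (A - {v}))) - 2 * sum b (A - {v})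
          \<le> real (\<Sum>v\<in>U. card (N v \<inter> U))" by blast
    have "(\<Sum>w\<in>A. card (N w \<inter> A)) =
        (\<Sum>w\<in>A - {v}. card (N w \<inter> (A - {v}))) + 2 * card (N v \<inter> A)"
      using psubset.hyps v(1) psubset.prems irr by (rule sum_card_neighbours_remove)
    then have "real (\<Sum>w\<in>A. card (N w \<inter> A)) =
        real (\<Sum>w\<in>A - {v}. card (N w \<inter> (A - {v}))) + 2 * real (card (N v \<inter> A))"
      by simp
    moreover have "sum b A = b v + sum b (A - {v})"
      using v psubset.hyps by (simp add: sum.remove)
    ultimately show ?thesis using U v by (intro exI[of _ U]) auto
  qed
qed

text \<open>
  For every point \<open>x\<close>, prune \<open>{v. x \<in> S v}\<close> to a set \<open>U x\<close> in which each vertex keeps a fixed proportion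
  of its degree. If \<open>x \<in> S' v\<close>, that is \<open>v \<in> U x\<close>, then a fixed proportion of the neighbours \<open>u\<close> of \<open>v\<close> satisfy
  \<open>x \<in> S' u\<close>, so the tree can be grown greedily, losing only a constant factor of the common points
  at each step. No regularity of the degrees is required.
\<close>

lemma tree_with_common_points:
  fixes N :: "'v \<Rightarrow> 'v set" and S :: "'v \<Rightarrow> 'x set" and e :: real
  assumes W: "finite W" "W \<noteq> {}" and X: "finite X" and e: "0 < e" "e \<le> 1"
    and sym: "\<And>u v. u \<in> W \<Longrightarrow> v \<in> W \<Longrightarrow> u \<in> N v \<longleftrightarrow> v \<in> N u" and irr: "\<And>v. v \<notin> N v"
    and deg: "\<And>v. v \<in> W \<Longrightarrow> 8 * (real t + 1) / e \<le> card (N v \<inter> W)"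
    and common: "\<And>u v. u \<in> W \<Longrightarrow> v \<in> W \<Longrightarrow> u \<in> N v \<Longrightarrow> e * card X \<le> card {x \<in> X. x \<in> S u \<and> x \<in> S v}"
    and par: "\<And>i. 1 \<le> i \<Longrightarrow> i \<le> t \<Longrightarrow> par i < i"
  shows "\<exists>f. inj_on f {..t} \<and> f ` {..t} \<subseteq> W \<and> (\<forall>i. 1 \<le> i \<and> i \<le> t \<longrightarrow> f i \<in> N (f (par i))) \<and>
    e / 2 * (e / 8) ^ t * card X \<le> card {x \<in> X. \<forall>i\<le>t. x \<in> S (f i)}"
proof -
  define d where "d v = real (card (N v \<inter> W))" for v
  define A where "A x = {v \<in> W. x \<in> S v}" for x
  have dpos: "0 < d v" if "v \<in> W" for v
    using deg[OF that] e unfolding d_def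
    by (smt (verit) divide_pos_pos of_nat_0_le_iff)
  \<comment> \<open>With threshold e/4 the pruning loses at most 2 * e/4 = e/2 of the total weight,
    half of the proportion e that \<open>common\<close> guarantees.\<close>
  have "\<forall>x. \<exists>U\<subseteq>A x. (\<forall>v\<in>U. e / 4 * d v \<le> card (N v \<inter> U)) \<and>
      real (\<Sum>v\<in>A x. card (N v \<inter> A x)) - 2 * (\<Sum>v\<in>A x. e / 4 * d v) \<le> real (\<Sum>v\<in>U. card (N v \<inter> U))"
    using W e sym irr by (intro allI dense_core) (auto simp: A_def d_def)
  then obtain U where U: "\<And>x. U x \<subseteq> A x"
      "\<And>x v. v \<in> U x \<Longrightarrow> e / 4 * d v \<le> card (N v \<inter> U x)"
      "\<And>x. real (\<Sum>v\<in>A x. card (N v \<inter> A x)) - 2 * (\<Sum>v\<in>A x. e / 4 * d v)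
        \<le> real (\<Sum>v\<in>U x. card (N v \<inter> U x))" by metis
  have UW: "U x \<subseteq> W" for x using U(1)[of x] by (auto simp: A_def)
  define S' where "S' v = {x \<in> X. v \<in> U x}" for v
  have S'S: "x \<in> S v" if "x \<in> S' v" for x v using that U(1)[of x] by (auto simp: S'_def A_def)
  define M where "M = (\<Sum>v\<in>W. d v)"
  \<comment> \<open>Both sides of the resulting equation count triples of a point \<open>x\<close>
    and an ordered adjacent pair in \<open>A x\<close>.\<close>
  have "(\<Sum>x\<in>X. \<Sum>v\<in>A x. card (N v \<inter> A x)) = (\<Sum>v\<in>W. \<Sum>x\<in>{x\<in>X. x \<in> S v}. card (N v \<inter> A x))"
    unfolding A_def using X W(1) by (rule sum.swap_restrict)
  also have "\<dots> = (\<Sum>v\<in>W. \<Sum>x\<in>{x\<in>X. x \<in> S v}. \<Sum>u\<in>{u \<in> N v \<inter> W. x \<in> S u}. 1)"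
  proof -
    have "N v \<inter> A x = {u \<in> N v \<inter> W. x \<in> S u}" for v x by (auto simp: A_def)
    then show ?thesis by simp
  qed
  also have "\<dots> = (\<Sum>v\<in>W. \<Sum>u\<in>N v \<inter> W. \<Sum>x\<in>{x\<in>{x\<in>X. x \<in> S v}. x \<in> S u}. 1)"
    using X W by (intro sum.cong refl sum.swap_restrict) auto
  also have "\<dots> = (\<Sum>v\<in>W. \<Sum>u\<in>N v \<inter> W. card {x\<in>X. x \<in> S u \<and> x \<in> S v})"
    by (intro sum.cong refl) (auto intro!: arg_cong[where f = card])
  finally have eq: "(\<Sum>x\<in>X. \<Sum>v\<in>A x. card (N v \<inter> A x)) =
      (\<Sum>v\<in>W. \<Sum>u\<in>N v \<inter> W. card {x\<in>X. x \<in> S u \<and> x \<in> S v})" .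
  have "e * card X * M = (\<Sum>v\<in>W. \<Sum>u\<in>N v \<inter> W. e * card X)"
    by (simp add: M_def d_def sum_distrib_left sum_distrib_right mult_ac)
  also have "\<dots> \<le> (\<Sum>v\<in>W. \<Sum>u\<in>N v \<inter> W. real (card {x\<in>X. x \<in> S u \<and> x \<in> S v}))"
    using common by (intro sum_mono) auto
  also have "\<dots> = real (\<Sum>x\<in>X. \<Sum>v\<in>A x. card (N v \<inter> A x))" unfolding eq by simp
  finally have 1: "e * card X * M \<le> real (\<Sum>x\<in>X. \<Sum>v\<in>A x. card (N v \<inter> A x))" .
  have "(\<Sum>x\<in>X. \<Sum>v\<in>A x. e / 4 * d v) \<le> (\<Sum>x\<in>X. \<Sum>v\<in>W. e / 4 * d v)"
    using W e by (intro sum_mono sum_mono2) (auto simp: A_def d_def)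
  also have "\<dots> = e / 4 * card X * M"
    by (simp add: M_def sum_distrib_left sum_distrib_right mult_ac)
  finally have 2: "(\<Sum>x\<in>X. \<Sum>v\<in>A x. e / 4 * d v) \<le> e / 4 * card X * M" .
  have "(\<Sum>x\<in>X. real (\<Sum>v\<in>A x. card (N v \<inter> A x)) - 2 * (\<Sum>v\<in>A x. e / 4 * d v))
      \<le> (\<Sum>x\<in>X. real (\<Sum>v\<in>U x. card (N v \<inter> U x)))"
    by (intro sum_mono U(3))
  also have "\<dots> \<le> (\<Sum>x\<in>X. \<Sum>v\<in>U x. d v)"
  proof (rule sum_mono)
    fix x
    have "real (\<Sum>v\<in>U x. card (N v \<inter> U x)) = (\<Sum>v\<in>U x. real (card (N v \<inter> U x)))" by simp
    also have "\<dots> \<le> (\<Sum>v\<in>U x. d v)"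
      unfolding d_def using UW[of x] W by (intro sum_mono of_nat_mono card_mono) auto
    finally show "real (\<Sum>v\<in>U x. card (N v \<inter> U x)) \<le> (\<Sum>v\<in>U x. d v)" .
  qed
  also have "\<dots> = (\<Sum>x\<in>X. \<Sum>v\<in>{v \<in> W. v \<in> U x}. d v)"
    using UW by (intro sum.cong) auto
  also have "\<dots> = (\<Sum>v\<in>W. \<Sum>x\<in>{x\<in>X. v \<in> U x}. d v)"
    using X W by (intro sum.swap_restrict)
  also have "\<dots> = (\<Sum>v\<in>W. d v * card (S' v))" by (simp add: S'_def mult.commute)
  finally have 3: "real (\<Sum>x\<in>X. \<Sum>v\<in>A x. card (N v \<inter> A x)) - 2 * (\<Sum>x\<in>X. \<Sum>v\<in>A x. e / 4 * d v)
      \<le> (\<Sum>v\<in>W. d v * card (S' v))"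
    by (simp add: sum_subtractf sum_distrib_left)
  have 4: "e / 2 * card X * M \<le> (\<Sum>v\<in>W. d v * card (S' v))" using 1 2 3 by linarith
  \<comment> \<open>The average over \<open>W\<close> is weighted by the degrees \<open>d v\<close>,
    of total weight \<open>M\<close>. The vertex found becomes the root of the tree.\<close>
  have "\<exists>v\<in>W. e / 2 * card X \<le> card (S' v)"
  proof (rule ccontr)
    assume "\<not> ?thesis"
    then have "(\<Sum>v\<in>W. d v * card (S' v)) < (\<Sum>v\<in>W. d v * (e / 2 * card X))"
      using W dpos by (intro sum_strict_mono) auto
    also have "\<dots> = e / 2 * card X * M" by (simp add: M_def sum_distrib_left sum_distrib_right mult_ac)
    finally show False using 4 by simp
  qed
  then obtain r where r: "r \<in> W" "e / 2 * card X \<le> card (S' r)" by blast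
  have "s \<le> t \<Longrightarrow> \<exists>f. inj_on f {..s} \<and> f ` {..s} \<subseteq> W \<and>
      (\<forall>i. 1 \<le> i \<and> i \<le> s \<longrightarrow> f i \<in> N (f (par i))) \<and>
      e / 2 * (e / 8) ^ s * card X \<le> card {x \<in> X. \<forall>i\<le>s. x \<in> S' (f i)}" for s
  proof (induction s)
    case 0
    have "{x \<in> X. x \<in> S' r} = S' r" by (auto simp: S'_def)
    then show ?case using r by (intro exI[of _ "\<lambda>_. r"]) auto
  next
    case (Suc s)
    then obtain f where f: "inj_on f {..s}" "f ` {..s} \<subseteq> W"
      "\<forall>i. 1 \<le> i \<and> i \<le> s \<longrightarrow> f i \<in> N (f (par i))"
      "e / 2 * (e / 8) ^ s * card X \<le> card {x \<in> X. \<forall>i\<le>s. x \<in> S' (f i)}" by auto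
    define Z where "Z = {x \<in> X. \<forall>i\<le>s. x \<in> S' (f i)}"
    define v where "v = f (par (Suc s))"
    have ps: "par (Suc s) \<le> s" using par[of "Suc s"] Suc.prems by auto
    then have vW: "v \<in> W" using f(2) by (auto simp: v_def)
    define B where "B = f ` {..s}"
    have B: "finite B" "card B \<le> s + 1"
      unfolding B_def using card_image_le[of "{..s}" f] by auto
    \<comment> \<open>The degree hypothesis serves this bound: the vertices already used block at
      most half of the e/4 * d v neighbours that each point of \<open>Z\<close> guarantees.\<close>
    have sB: "real (card B) \<le> e / 8 * d v"
    proof -
      have "real (card B) \<le> real t + 1" using B Suc.prems by linarith
      also have "\<dots> = e / 8 * (8 * (real t + 1) / e)" using e by simp
      also have "\<dots> \<le> e / 8 * d v" using deg[OF vW] e unfolding d_def by (intro mult_left_mono) auto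
      finally show ?thesis .
    qed
    define C where "C = N v \<inter> W - B"
    have "e / 8 * d v < 1 * d v" using e dpos[OF vW] by (intro mult_strict_right_mono) auto
    then have "real (card B) < d v" using sB by simp
    then have "card B < card (N v \<inter> W)" by (simp add: d_def)
    then have C: "C \<noteq> {}" unfolding C_def
      using B card_mono[of B "N v \<inter> W"] by auto
    have cC: "card C \<le> d v" unfolding C_def d_def using W by (auto intro!: card_mono)
    have ge: "e / 8 * d v \<le> card {u \<in> C. x \<in> S' u}" if "x \<in> Z" for x
    proof -
      have "x \<in> S' v" "x \<in> X" using that ps by (auto simp: Z_def v_def)
      then have "e / 4 * d v \<le> card (N v \<inter> U x)" using U(2)[of v x] by (auto simp: S'_def)
      also have "N v \<inter> U x \<subseteq> {u \<in> C. x \<in> S' u} \<union> B"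
        using UW[of x] \<open>x \<in> X\<close> by (auto simp: C_def S'_def)
      then have "card (N v \<inter> U x) \<le> card ({u \<in> C. x \<in> S' u} \<union> B)"
        using W B by (intro card_mono) (auto simp: C_def)
      also have "\<dots> \<le> card {u \<in> C. x \<in> S' u} + card B" by (rule card_Un_le)
      finally show ?thesis using sB by simp
    qed
    have finZ: "finite Z" using X by (simp add: Z_def)
    \<comment> \<open>Double counting: each point of \<open>Z\<close> accepts at least e/8 * d v of
      the at most \<open>d v\<close> candidates, so one candidate keeps a proportion e/8 of
      \<open>Z\<close>.\<close>
    have "d v * (e / 8 * card Z) = (\<Sum>x\<in>Z. e / 8 * d v)" by simp
    also have "\<dots> \<le> (\<Sum>x\<in>Z. real (card {u \<in> C. x \<in> S' u}))" by (intro sum_mono ge)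
    also have "\<dots> = real (\<Sum>x\<in>Z. \<Sum>u\<in>{u \<in> C. x \<in> S' u}. 1)" by simp
    also have "(\<Sum>x\<in>Z. \<Sum>u\<in>{u \<in> C. x \<in> S' u}. 1) = (\<Sum>u\<in>C. \<Sum>x\<in>{x \<in> Z. x \<in> S' u}. 1)"
      using finZ W by (intro sum.swap_restrict) (auto simp: C_def)
    finally have "d v * (e / 8 * card Z) \<le> (\<Sum>u\<in>C. real (card {x \<in> Z. x \<in> S' u}))" by simp
    then have "\<exists>u\<in>C. e / 8 * card Z \<le> card {x \<in> Z. x \<in> S' u}"
      using C W cC e by (intro averaging[where k = "d v"]) (auto simp: C_def)
    then obtain u where u: "u \<in> C" "e / 8 * card Z \<le> card {x \<in> Z. x \<in> S' u}" by blast
    define g where "g = f(Suc s := u)"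
    have gi: "g i = f i" if "i \<le> s" for i using that by (simp add: g_def)
    have gS: "g (Suc s) = u" by (simp add: g_def)
    have "(\<forall>i\<le>Suc s. x \<in> S' (g i)) \<longleftrightarrow> (\<forall>i\<le>s. x \<in> S' (f i)) \<and> x \<in> S' u" for x
      unfolding le_Suc_eq using gi gS by (metis (no_types, lifting))
    then have Zu: "{x \<in> Z. x \<in> S' u} = {x \<in> X. \<forall>i\<le>Suc s. x \<in> S' (g i)}"
      by (simp add: Z_def)
    have "e / 2 * (e / 8) ^ Suc s * card X \<le> e / 8 * card Z"
      using mult_left_mono[OF f(4), of "e / 8"] e by (simp add: Z_def mult_ac)
    then have "e / 2 * (e / 8) ^ Suc s * card X \<le> card {x \<in> X. \<forall>i\<le>Suc s. x \<in> S' (g i)}"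
      using u(2) unfolding Zu by (rule order_trans)
    moreover have "inj_on g {..Suc s}"
    proof -
      have "u \<notin> f ` {..s}" using u(1) by (simp add: C_def B_def)
      moreover have "inj_on g {..s}" using f(1) gi by (auto simp: inj_on_def)
      moreover have "g ` {..s} = f ` {..s}" using gi by auto
      moreover have "g (Suc s) = u" by (simp add: g_def)
      ultimately show ?thesis by (simp add: atMost_Suc)
    qed
    moreover have "g ` {..Suc s} \<subseteq> W"
      using f(2) u(1) gi by (auto simp: atMost_Suc C_def) (simp add: g_def)
    moreover have "g i \<in> N (g (par i))" if "1 \<le> i" "i \<le> Suc s" for i
    proof (cases "i \<le> s")
      case True
      have "par i < i" using par[of i] that Suc.prems by auto
      then have "par i \<le> s" using True by simp
      then show ?thesis using True f(3) gi that by auto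
    next
      case False
      then have "i = Suc s" using that by simp
      then show ?thesis using u(1) ps gi by (simp add: g_def C_def v_def)
    qed
    ultimately show ?case by blast
  qed
  from this[of t] obtain f where f: "inj_on f {..t}" "f ` {..t} \<subseteq> W"
    "\<forall>i. 1 \<le> i \<and> i \<le> t \<longrightarrow> f i \<in> N (f (par i))"
    "e / 2 * (e / 8) ^ t * card X \<le> card {x \<in> X. \<forall>i\<le>t. x \<in> S' (f i)}" by auto
  have "card {x \<in> X. \<forall>i\<le>t. x \<in> S' (f i)} \<le> card {x \<in> X. \<forall>i\<le>t. x \<in> S (f i)}"
    using X S'S by (intro card_mono) auto
  then show ?thesis using f by (intro exI[of _ f]) (auto intro: order_trans)
qed

section \<open>Attaching the leaves and the cloud to a tree\<close>

text \<open>The vertices \<open>g j\<close> are chosen one at a time. Forbidden and earlier choices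
  block at most q/2 vertices, so every surviving \<open>w\<close> still has q/2 neighbours in
  \<open>T j\<close>; by averaging, some choice keeps a proportion q / (2 * card V) of the
  survivors.\<close>

lemma common_neighbours_tuple:
  fixes N :: "'v \<Rightarrow> 'v set" and q :: real
  assumes "finite J" and V: "finite V" "V \<noteq> {}" and sym: "\<And>u v. u \<in> N v \<longleftrightarrow> v \<in> N u"
    and T: "\<And>j. j \<in> J \<Longrightarrow> T j \<subseteq> V"
    and Z: "finite Z" "Z \<noteq> {}" "\<And>w j. w \<in> Z \<Longrightarrow> j \<in> J \<Longrightarrow> q \<le> card (N w \<inter> T j)"
    and B: "finite B" "2 * (real (card B) + card J) \<le> q"
  shows "\<exists>g Z'. inj_on g J \<and> g ` J \<inter> B = {} \<and> (\<forall>j\<in>J. g j \<in> T j) \<and> Z' \<subseteq> Z \<and>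
    (\<forall>j\<in>J. Z' \<subseteq> N (g j)) \<and> card Z * (q / (2 * card V)) ^ card J \<le> card Z'"
  using assms(1) T Z(3) B(2)
proof (induction J rule: finite_induct)
  case empty
  then show ?case by (intro exI[of _ undefined] exI[of _ Z]) auto
next
  case (insert j J)
  have "\<exists>g Z'. inj_on g J \<and> g ` J \<inter> B = {} \<and> (\<forall>j\<in>J. g j \<in> T j) \<and> Z' \<subseteq> Z \<and>
    (\<forall>j\<in>J. Z' \<subseteq> N (g j)) \<and> card Z * (q / (2 * card V)) ^ card J \<le> card Z'"
    using insert.prems insert.hyps by (intro insert.IH) auto
  then obtain g Z' where g: "inj_on g J" "g ` J \<inter> B = {}" "\<forall>j\<in>J. g j \<in> T j" "Z' \<subseteq> Z"
    "\<forall>j\<in>J. Z' \<subseteq> N (g j)" "card Z * (q / (2 * card V)) ^ card J \<le> card Z'" by blast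
  have finZ': "finite Z'" using g(4) Z(1) by (rule finite_subset)
  have q: "2 * (real (card B) + card J + 1) \<le> q" using insert by auto
  have cV: "0 < card V" using V by (simp add: card_gt_0_iff)
  define K where "K = T j - (B \<union> g ` J)"
  have ge: "q / 2 \<le> card {y \<in> K. w \<in> N y}" if "w \<in> Z'" for w
  proof -
    have q1: "q \<le> card (N w \<inter> T j)" using insert.prems(2)[of w j] that g(4) by auto
    have "N w \<inter> T j \<subseteq> {y \<in> K. w \<in> N y} \<union> (B \<union> g ` J)"
      using sym by (auto simp: K_def)
    then have "card (N w \<inter> T j) \<le> card ({y \<in> K. w \<in> N y} \<union> (B \<union> g ` J))"
      using insert.prems(1)[of j] V B insert.hyps unfolding K_def
      by (intro card_mono) (auto intro: finite_subset)
    also have "\<dots> \<le> card {y \<in> K. w \<in> N y} + card (B \<union> g ` J)" by (rule card_Un_le)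
    finally have "card (N w \<inter> T j) \<le> card {y \<in> K. w \<in> N y} + card (B \<union> g ` J)" .
    moreover have "card (B \<union> g ` J) \<le> card B + card J"
      using card_Un_le[of B "g ` J"] card_image_le[of J g] insert.hyps by linarith
    ultimately have "card (N w \<inter> T j) \<le> card {y \<in> K. w \<in> N y} + (card B + card J)"
      by linarith
    then have "real (card (N w \<inter> T j)) \<le>
        real (card {y \<in> K. w \<in> N y}) + (real (card B) + real (card J))"
      by (simp flip: of_nat_add)
    then show ?thesis using q q1 by (simp add: field_simps)
  qed
  have finK: "finite K" using insert.prems(1)[of j] V by (auto simp: K_def intro: finite_subset)
  have KV: "card K \<le> card V" using insert.prems(1)[of j] V by (auto simp: K_def intro!: card_mono)
  have "0 < card Z * (q / (2 * card V)) ^ card J"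
    using Z cV q by (simp add: card_gt_0_iff)
  then have Z': "Z' \<noteq> {}" using g(6) by auto
  then obtain w where "w \<in> Z'" by auto
  from ge[OF this] q have "0 < real (card {y \<in> K. w \<in> N y})" by (simp add: field_simps)
  then have K: "K \<noteq> {}" by (auto simp: card_gt_0_iff)
  have "real (card V) * (card Z' * (q / (2 * card V))) = (\<Sum>w\<in>Z'. q / 2)" using cV by simp
  also have "\<dots> \<le> (\<Sum>w\<in>Z'. real (card {y \<in> K. w \<in> N y}))"
    by (intro sum_mono ge)
  also have "\<dots> = real (\<Sum>w\<in>Z'. \<Sum>y\<in>{y \<in> K. w \<in> N y}. 1)" by simp
  also have "(\<Sum>w\<in>Z'. \<Sum>y\<in>{y \<in> K. w \<in> N y}. 1) = (\<Sum>y\<in>K. \<Sum>w\<in>{w\<in>Z'. w \<in> N y}. 1)"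
    using finZ' finK by (intro sum.swap_restrict)
  finally have "real (card V) * (card Z' * (q / (2 * card V))) \<le> (\<Sum>y\<in>K. real (card {w\<in>Z'. w \<in> N y}))"
    by simp
  then have "\<exists>y\<in>K. card Z' * (q / (2 * card V)) \<le> card {w\<in>Z'. w \<in> N y}"
    using K finK KV q by (intro averaging[where k = "card V"]) auto
  then obtain y where y: "y \<in> K" "card Z' * (q / (2 * card V)) \<le> card {w \<in> Z'. w \<in> N y}"
    by blast
  have step: "card Z * (q / (2 * card V)) ^ card (insert j J) \<le> card {w \<in> Z'. w \<in> N y}"
  proof -
    have "card Z * (q / (2 * card V)) ^ card (insert j J) =
        card Z * (q / (2 * card V)) ^ card J * (q / (2 * card V))"
      using insert.hyps by simp
    also have "\<dots> \<le> card Z' * (q / (2 * card V))"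
      using g(6) q by (intro mult_right_mono) auto
    finally show ?thesis using y(2) by linarith
  qed
  have "inj_on (g(j := y)) (insert j J)"
    using g(1) y(1) insert.hyps by (auto simp: inj_on_def K_def)
  moreover have "(g(j := y)) ` insert j J \<inter> B = {}"
    using g(2) y(1) insert.hyps by (auto simp: K_def)
  moreover have "\<forall>i\<in>insert j J. (g(j := y)) i \<in> T i"
    using g(3) y(1) insert.hyps by (auto simp: K_def)
  moreover have "\<forall>i\<in>insert j J. {w \<in> Z'. w \<in> N y} \<subseteq> N ((g(j := y)) i)"
    using g(5) by auto
  moreover have "{w \<in> Z'. w \<in> N y} \<subseteq> Z" using g(4) by auto
  ultimately show ?case using step
    by (intro exI[of _ "g(j := y)"] exI[of _ "{w \<in> Z'. w \<in> N y}"] conjI)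
qed

text \<open>\<open>L\<close> is mapped into the tree \<open>f\<close>, and each vertex
  \<open>j\<close> of \<open>J\<close> to a neighbour of the tree vertex labelled
  \<open>att j\<close>. Since \<open>I\<close> has edges to \<open>J\<close> only, it may be placed
  injectively anywhere in the set \<open>Z'\<close> of common neighbours of the images of
  \<open>J\<close>, away from vertices already used. The second bound in \<open>q\<close> makes room
  for this.\<close>

lemma embed_cloud_forest:
  fixes N :: "'v \<Rightarrow> 'v set" and E :: "'a rel" and lab att :: "'a \<Rightarrow> nat" and q :: real
  assumes H: "finite I" "finite J" "I \<inter> J = {}" "I \<inter> L = {}" "J \<inter> L = {}"
    and lab: "inj_on lab L" "lab ` L \<subseteq> {..t}" and att: "att ` J \<subseteq> {..t}"
    and E: "\<And>x y. (x, y) \<in> E \<Longrightarrow> x \<in> I \<and> y \<in> J \<or> x \<in> J \<and> y \<in> I \<or>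
      x \<in> J \<and> y \<in> L \<and> att x = lab y \<or> x \<in> L \<and> y \<in> J \<and> att y = lab x \<or>
      x \<in> L \<and> y \<in> L \<and> (1 \<le> lab x \<and> par (lab x) = lab y \<or> 1 \<le> lab y \<and> par (lab y) = lab x)"
    and V: "finite V" "V \<noteq> {}" and N: "\<And>u v. u \<in> N v \<longleftrightarrow> v \<in> N u" "\<And>v. N v \<subseteq> V"
    and f: "inj_on f {..t}" "f ` {..t} \<subseteq> V" "\<And>i. 1 \<le> i \<Longrightarrow> i \<le> t \<Longrightarrow> f i \<in> N (f (par i))"
    and Z: "Z \<subseteq> V" "Z \<noteq> {}" "\<And>w i. w \<in> Z \<Longrightarrow> i \<le> t \<Longrightarrow> q \<le> card (N w \<inter> N (f i))"
    and q: "2 * (real t + 1 + card J) \<le> q"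
      "real t + 1 + card J + card I \<le> card Z * (q / (2 * card V)) ^ card J"
  shows "\<exists>g. inj_on g (I \<union> J \<union> L) \<and> g ` (I \<union> J \<union> L) \<subseteq> V \<and> (\<forall>(x, y)\<in>E. g y \<in> N (g x))"
proof -
  define B where "B = f ` {..t}"
  have B: "finite B" "card B = t + 1" using f(1) by (auto simp: B_def card_image)
  have finZ: "finite Z" using Z(1) V(1) by (rule finite_subset)
  have "\<exists>g Z'. inj_on g J \<and> g ` J \<inter> B = {} \<and> (\<forall>j\<in>J. g j \<in> N (f (att j))) \<and> Z' \<subseteq> Z \<and>
    (\<forall>j\<in>J. Z' \<subseteq> N (g j)) \<and> card Z * (q / (2 * card V)) ^ card J \<le> card Z'"
  proof (rule common_neighbours_tuple)
    show "u \<in> N v \<longleftrightarrow> v \<in> N u" for u v by (rule N(1))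
    show "q \<le> card (N w \<inter> N (f (att j)))" if "w \<in> Z" "j \<in> J" for w j
      using Z(3)[of w "att j"] that att by auto
    show "2 * (real (card B) + card J) \<le> q" using q(1) B by simp
  qed (use H(2) V N(2) finZ Z(2) B(1) in auto)
  then obtain g Z' where g: "inj_on g J" "g ` J \<inter> B = {}" "\<forall>j\<in>J. g j \<in> N (f (att j))"
    "Z' \<subseteq> Z" "\<forall>j\<in>J. Z' \<subseteq> N (g j)"
    "card Z * (q / (2 * card V)) ^ card J \<le> card Z'" by blast
  have "real t + 1 + card J + card I \<le> card Z'" using g(6) q(2) by linarith
  then have "t + 1 + card J + card I \<le> card Z'" by linarith
  moreover have "card (B \<union> g ` J) \<le> t + 1 + card J"
    using card_Un_le[of B "g ` J"] card_image_le[of J g] H B by linarith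
  moreover have "card Z' - card (B \<union> g ` J) \<le> card (Z' - (B \<union> g ` J))"
    using B H by (intro diff_card_le_card_Diff) auto
  ultimately have "card I \<le> card (Z' - (B \<union> g ` J))" by linarith
  moreover have "finite (Z' - (B \<union> g ` J))" using g(4) finZ finite_subset by auto
  ultimately obtain h where h: "h ` I \<subseteq> Z' - (B \<union> g ` J)" "inj_on h I"
    using card_le_inj[of I "Z' - (B \<union> g ` J)"] H(1) by auto
  define k where "k x = (if x \<in> I then h x else if x \<in> J then g x else f (lab x))" for x
  have kI: "k x = h x" if "x \<in> I" for x using that by (simp add: k_def)
  have kJ: "k x = g x" if "x \<in> J" for x using that H by (auto simp: k_def)
  have kL: "k x = f (lab x)" if "x \<in> L" for x using that H by (auto simp: k_def)
  have imI: "k ` I = h ` I" and imJ: "k ` J = g ` J" and imL: "k ` L = f ` lab ` L"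
    using kI kJ kL by (auto simp: image_image)
  have LB: "k ` L \<subseteq> B" unfolding imL B_def using lab(2) by auto
  have "inj_on (f \<circ> lab) L"
    using lab f(1) by (intro comp_inj_on) (auto intro: inj_on_subset)
  then have "inj_on k I" "inj_on k J" "inj_on k L"
    using h(2) g(1) kI kJ kL by (auto simp: inj_on_def)
  moreover have "k ` I \<inter> k ` J = {}" "k ` I \<inter> k ` L = {}" "k ` J \<inter> k ` L = {}"
    using LB h(1) g(2) unfolding imI imJ by blast+
  ultimately have "inj_on k (I \<union> J \<union> L)"
    by (auto simp: inj_on_Un image_Un)
  moreover have "k ` (I \<union> J \<union> L) \<subseteq> V"
  proof -
    have "k ` I \<subseteq> V" unfolding imI using h(1) g(4) Z(1) by blast
    moreover have "k ` J \<subseteq> V" unfolding imJ using g(3) N(2) by blast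
    moreover have "k ` L \<subseteq> V" using LB f(2) by (auto simp: B_def)
    ultimately show ?thesis by auto
  qed
  moreover have "k y \<in> N (k x)" if xy: "(x, y) \<in> E" for x y
  proof -
    have IJ: "h i \<in> N (g j)" if "i \<in> I" "j \<in> J" for i j using that h(1) g(5) by blast
    consider "x \<in> I" "y \<in> J" | "x \<in> J" "y \<in> I" | "x \<in> J" "y \<in> L" "att x = lab y"
      | "x \<in> L" "y \<in> J" "att y = lab x"
      | "x \<in> L" "y \<in> L" "1 \<le> lab x" "par (lab x) = lab y"
      | "x \<in> L" "y \<in> L" "1 \<le> lab y" "par (lab y) = lab x"
      using E[OF xy] by blast
    then show ?thesis
    proof cases
      case 1
      then show ?thesis using IJ[of x y] N(1) by (simp add: kI kJ)
    next
      case 2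
      then show ?thesis using IJ[of y x] by (simp add: kI kJ)
    next
      case 3
      then have "g x \<in> N (f (lab y))" using g(3) by metis
      then show ?thesis using 3 N(1)[of "f (lab y)" "g x"] by (simp add: kJ kL)
    next
      case 4
      then have "g y \<in> N (f (lab x))" using g(3) by metis
      then show ?thesis using 4 by (simp add: kJ kL)
    next
      case 5
      then have "f (lab x) \<in> N (f (lab y))" using f(3)[of "lab x"] lab(2) by auto
      then show ?thesis using 5 N(1)[of "f (lab y)" "f (lab x)"] by (simp add: kL)
    next
      case 6
      then have "f (lab y) \<in> N (f (lab x))" using f(3)[of "lab y"] lab(2) by auto
      then show ?thesis using 6 by (simp add: kL)
    qed
  qed
  ultimately show ?thesis by (intro exI[of _ k]) auto
qed

section \<open>The bipartite remainder\<close>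

text \<open>The sizes add up to at least (1 + 6e) |V|, so the three pairwise intersections together
  have at least 6e |V| elements.\<close>

lemma three_large_sets_meet:
  fixes e :: real
  assumes "finite V" "A \<subseteq> V" "B \<subseteq> V" "C \<subseteq> V" "0 \<le> e"
    and "(1/3 + 2 * e) * card V \<le> card A" "(1/3 + 2 * e) * card V \<le> card B"
      "(1/3 + 2 * e) * card V \<le> card C"
  shows "2 * e * card V \<le> card (A \<inter> B) \<or> 2 * e * card V \<le> card (A \<inter> C) \<or> 2 * e * card V \<le> card (B \<inter> C)"
proof -
  have fin: "finite A" "finite B" "finite C" using assms finite_subset by blast+
  have 1: "card A + card B = card (A \<union> B) + card (A \<inter> B)"
    by (rule card_Un_Int[OF fin(1,2)])
  have 2: "card (A \<union> B) + card C = card (A \<union> B \<union> C) + card ((A \<union> B) \<inter> C)"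
    using fin by (intro card_Un_Int) auto
  have 3: "card ((A \<union> B) \<inter> C) \<le> card (A \<inter> C) + card (B \<inter> C)"
    unfolding Int_Un_distrib2 by (rule card_Un_le)
  have 4: "card (A \<union> B \<union> C) \<le> card V" using assms by (intro card_mono) auto
  have "card A + card B + card C \<le> card V + card (A \<inter> B) + card (A \<inter> C) + card (B \<inter> C)"
    using 1 2 3 4 by linarith
  then have "real (card A) + real (card B) + real (card C)
      \<le> real (card V) + real (card (A \<inter> B)) + real (card (A \<inter> C)) + real (card (B \<inter> C))"
    by (simp flip: of_nat_add)
  then show ?thesis using assms(6-8) by (auto simp: algebra_simps)
qed

lemma large_sets_meet:
  fixes e :: real
  assumes "finite V" "A \<subseteq> Y" "B \<subseteq> Y" "Y \<subseteq> V" "0 \<le> e" "card Y < (2/3) * card V"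
    and "(1/3 + 2 * e) * card V \<le> card A" "(1/3 + 2 * e) * card V \<le> card B"
  shows "4 * e * card V \<le> card (A \<inter> B)"
proof -
  have fin: "finite A" "finite B" "finite Y" using assms finite_subset by (meson finite_subset)+
  have 1: "card A + card B = card (A \<union> B) + card (A \<inter> B)"
    by (rule card_Un_Int[OF fin(1,2)])
  have 2: "card (A \<union> B) \<le> card Y" using assms fin by (intro card_mono) auto
  have "card A + card B \<le> card Y + card (A \<inter> B)" using 1 2 by linarith
  then have "real (card A) + real (card B) \<le> real (card Y) + real (card (A \<inter> B))"
    by (simp flip: of_nat_add)
  then show ?thesis using assms(6-8) by (auto simp: algebra_simps)
qed

text \<open>Count paths \<open>y\<close>, \<open>x\<close>, \<open>y'\<close> with middle vertex in
  \<open>Y\<close>: each \<open>x\<close> contributes at least a^2 of them, and at most |V|^2 pairs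
  of ends share them.\<close>

lemma dense_bipartite_pairs:
  fixes N :: "'v \<Rightarrow> 'v set" and a c :: real
  assumes V: "finite V" and Q: "Q \<subseteq> V" "Q' \<subseteq> V" and sym: "\<And>u v. u \<in> N v \<longleftrightarrow> v \<in> N u"
    and Y: "Y \<subseteq> V" "Y \<noteq> {}" "0 < a"
    and deg: "\<And>x. x \<in> Y \<Longrightarrow> a \<le> card (N x \<inter> Q)" "\<And>x. x \<in> Y \<Longrightarrow> a \<le> card (N x \<inter> Q')"
    and c: "c * real (card V) ^ 2 \<le> card Y * a\<^sup>2" "0 \<le> c"
  shows "\<exists>y\<in>Q. \<exists>y'\<in>Q'. c \<le> card {x \<in> V. x \<in> N y \<and> x \<in> N y'}"
proof -
  have fin: "finite Q" "finite Q'" "finite Y" using V Q Y by (meson finite_subset)+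
  define f where "f q = real (card {x \<in> V. x \<in> N (fst q) \<and> x \<in> N (snd q)})" for q
  have 1: "a\<^sup>2 \<le> card {q \<in> Q \<times> Q'. x \<in> N (fst q) \<and> x \<in> N (snd q)}" if "x \<in> Y" for x
  proof -
    have "{q \<in> Q \<times> Q'. x \<in> N (fst q) \<and> x \<in> N (snd q)} = (N x \<inter> Q) \<times> (N x \<inter> Q')"
      using sym by auto
    moreover have "a * a \<le> real (card (N x \<inter> Q)) * real (card (N x \<inter> Q'))"
      using deg[OF that] Y by (intro mult_mono) auto
    ultimately show ?thesis by (simp add: card_cartesian_product power2_eq_square)
  qed
  have ne: "Q \<times> Q' \<noteq> {}"
  proof -
    obtain x where "x \<in> Y" using Y by blast
    from deg[OF this] Y have "N x \<inter> Q \<noteq> {}" "N x \<inter> Q' \<noteq> {}" by auto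
    then show ?thesis by auto
  qed
  have "real (card V) ^ 2 * c \<le> (\<Sum>x\<in>Y. a\<^sup>2)" using c by (simp add: mult.commute)
  also have "\<dots> \<le> (\<Sum>x\<in>Y. real (card {q \<in> Q \<times> Q'. x \<in> N (fst q) \<and> x \<in> N (snd q)}))"
    by (intro sum_mono 1)
  also have "\<dots> = real (\<Sum>x\<in>Y. \<Sum>q\<in>{q \<in> Q \<times> Q'. x \<in> N (fst q) \<and> x \<in> N (snd q)}. 1)" by simp
  also have "(\<Sum>x\<in>Y. \<Sum>q\<in>{q \<in> Q \<times> Q'. x \<in> N (fst q) \<and> x \<in> N (snd q)}. 1)
      = (\<Sum>q\<in>Q \<times> Q'. \<Sum>x\<in>{x\<in>Y. x \<in> N (fst q) \<and> x \<in> N (snd q)}. 1)"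
    using fin by (intro sum.swap_restrict) auto
  also have "real \<dots> = (\<Sum>q\<in>Q \<times> Q'. real (card {x\<in>Y. x \<in> N (fst q) \<and> x \<in> N (snd q)}))" by simp
  also have "\<dots> \<le> sum f (Q \<times> Q')"
    unfolding f_def using V Y by (intro sum_mono of_nat_mono card_mono) auto
  finally have 2: "real (card V) ^ 2 * c \<le> sum f (Q \<times> Q')" .
  have "card (Q \<times> Q') \<le> card V ^ 2"
    unfolding card_cartesian_product power2_eq_square
    using V Q by (intro mult_mono card_mono) auto
  then have "real (card (Q \<times> Q')) \<le> real (card V) ^ 2"
    by (metis of_nat_le_iff of_nat_power)
  then have "\<exists>q\<in>Q \<times> Q'. c \<le> f q"
    using fin ne c 2 by (intro averaging[where k = "real (card V) ^ 2"]) auto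
  then show ?thesis by (auto simp: f_def)
qed

text \<open>
  \<open>S k v\<close> consists of the vertices that have at least \<open>p\<^sup>k n\<close> common neighbours with \<open>v\<close>. Each use of
  the expansion hypothesis raises the exponent by 2, which is harmless because every fixed power
  of \<open>p\<close> is \<open>n\<^sup>-\<^sup>o\<^sup>(\<^sup>1\<^sup>)\<close>; this is why the thresholds 4, 5, 7, 15, 17 appear instead of regularity.
\<close>

lemma bipartite_remainder:
  fixes V :: "'v set" and N M :: "'v \<Rightarrow> 'v set" and e p :: real
  defines "S \<equiv> \<lambda>k v. {w \<in> V. p ^ k * card V \<le> card (N w \<inter> N v)}"
  assumes V: "finite V" and e: "0 < e" and p: "0 < p" "p \<le> 1/2" "p \<le> 4 * e"
    and N: "\<And>u v. u \<in> N v \<longleftrightarrow> v \<in> N u" "\<And>v. N v \<subseteq> V"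
    and M: "\<And>v. M v \<subseteq> N v" "\<And>u v. u \<in> M v \<longleftrightarrow> v \<in> M u"
    and expand: "\<And>U k. U \<subseteq> V \<Longrightarrow> 2 \<le> k \<Longrightarrow> k \<le> 15 \<Longrightarrow> p ^ k * card V \<le> card U \<Longrightarrow>
      (1/3 + 2 * e) * card V \<le> card {x \<in> V. p ^ (k + 2) * card V \<le> card (N x \<inter> U)}"
    and mindeg: "\<And>v. v \<in> V \<Longrightarrow> p ^ 2 * card V \<le> card (N v)"
    and sparse: "\<And>u v. u \<in> N v \<Longrightarrow> u \<notin> M v \<Longrightarrow> card (S 17 u \<inter> S 17 v) < e * card V"
    and few: "real (\<Sum>v\<in>V. card (M v)) < e * card V * (p ^ 5 * card V)"
  shows "\<exists>c. (\<forall>v\<in>V. c v < 2) \<and> (\<forall>u\<in>V. \<forall>v\<in>V. u \<in> N v - M v \<longrightarrow> c u \<noteq> (c v :: nat))"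
proof (cases "\<exists>a\<in>V. \<exists>b\<in>V. b \<in> N a - M a")
  case False
  then show ?thesis by (intro exI[of _ "\<lambda>_. 0"]) auto
next
  case True
  then obtain a b where ab: "a \<in> V" "b \<in> V" "b \<in> N a" "b \<notin> M a" by auto
  define n where "n = real (card V)"
  have n: "0 < n" using ab V by (auto simp: n_def card_gt_0_iff)
  have SV: "S k v \<subseteq> V" for k v by (auto simp: S_def)
  have pmono: "p ^ l * n \<le> p ^ k * n" if "k \<le> l" for k l
    using that p n by (intro mult_right_mono power_decreasing) auto
  have Smono: "S k v \<subseteq> S l v" if "k \<le> l" for k l v
    using pmono[OF that] by (auto simp: S_def n_def)
  \<comment> \<open>A vertex with p^17 n neighbours inside the common neighbourhood of
    \<open>u\<close> and \<open>v\<close> lies in both \<open>S 17 u\<close> and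
    \<open>S 17 v\<close>; one expansion with k = 15 produces enough of them.\<close>
  have large: "(1/3 + 2 * e) * n \<le> card (S 17 u \<inter> S 17 v)" if "p ^ 15 * n \<le> card (N u \<inter> N v)" for u v
  proof -
    have "(1/3 + 2 * e) * n \<le> card {x \<in> V. p ^ (15 + 2) * n \<le> card (N x \<inter> (N u \<inter> N v))}"
      using expand[of "N u \<inter> N v" 15] that N(2) unfolding n_def by auto
    also have "\<dots> \<le> card (S 17 u \<inter> S 17 v)"
    proof (intro of_nat_mono card_mono)
      show "finite (S 17 u \<inter> S 17 v)" using V SV by (meson finite_Int finite_subset)
      show "{x \<in> V. p ^ (15 + 2) * n \<le> card (N x \<inter> (N u \<inter> N v))} \<subseteq> S 17 u \<inter> S 17 v"
      proof
        fix x assume x: "x \<in> {x \<in> V. p ^ (15 + 2) * n \<le> card (N x \<inter> (N u \<inter> N v))}"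
        have "finite (N x)" using N(2) V finite_subset by blast
        then have "card (N x \<inter> (N u \<inter> N v)) \<le> card (N x \<inter> N u)"
            "card (N x \<inter> (N u \<inter> N v)) \<le> card (N x \<inter> N v)"
          by (auto intro!: card_mono)
        then show "x \<in> S 17 u \<inter> S 17 v" using x by (auto simp: S_def n_def)
      qed
    qed
    finally show ?thesis .
  qed
  have S4: "(1/3 + 2 * e) * n \<le> card (S 4 v)" if "v \<in> V" for v
    using expand[of "N v" 2] mindeg[OF that] N(2) by (simp add: S_def n_def)
  \<comment> \<open>Three edges outside \<open>M\<close> whose ends are cyclically linked by large codegrees would give
    three sets of more than a third of \<open>V\<close> with pairwise small intersections.\<close>
  have nine_cycle: False
    if "u \<in> N v - M v" "z \<in> N y - M y" "z' \<in> N y' - M y'"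
      "p ^ 15 * n \<le> card (N u \<inter> N z)" "p ^ 15 * n \<le> card (N v \<inter> N z')"
      "p ^ 15 * n \<le> card (N y \<inter> N y')" for u v z z' y y'
  proof -
    have le: "card ((S 17 i \<inter> S 17 j) \<inter> (S 17 k \<inter> S 17 l)) \<le> card (S 17 i \<inter> S 17 k)" for i j k l
      using V SV by (intro card_mono) (auto intro: finite_subset)
    have "card ((S 17 u \<inter> S 17 z) \<inter> (S 17 v \<inter> S 17 z')) < e * n"
      using le[of u z v z'] sparse[of u v] that by (auto simp: n_def)
    moreover have "card ((S 17 u \<inter> S 17 z) \<inter> (S 17 y \<inter> S 17 y')) < e * n"
      using le[of z u y y'] sparse[of z y] that by (auto simp: n_def Int_commute)
    moreover have "card ((S 17 v \<inter> S 17 z') \<inter> (S 17 y \<inter> S 17 y')) < e * n"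
      using le[of z' v y' y] sparse[of z' y'] that by (auto simp: n_def Int_commute)
    moreover have "e * n < 2 * e * n" using e n by simp
    ultimately show False
      using three_large_sets_meet[of V "S 17 u \<inter> S 17 z" "S 17 v \<inter> S 17 z'" "S 17 y \<inter> S 17 y'" e]
        large[OF that(4)] large[OF that(5)] large[OF that(6)] V SV e
      by (fastforce simp: n_def)
  qed
  \<comment> \<open>By Markov's inequality and \<open>few\<close>, there are fewer than e n vertices
    of large degree in \<open>M\<close>. Hence every set of e n vertices contains one that is not
    bad.\<close>
  define bad where "bad = {z \<in> V. p ^ 5 * n \<le> card (M z)}"
  have bad: "card bad < e * n"
  proof -
    have "card bad * (p ^ 5 * n) = (\<Sum>z\<in>bad. p ^ 5 * n)" by simp
    also have "\<dots> \<le> (\<Sum>z\<in>bad. real (card (M z)))" by (intro sum_mono) (auto simp: bad_def)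
    also have "\<dots> \<le> (\<Sum>z\<in>V. real (card (M z)))" using V by (intro sum_mono2) (auto simp: bad_def)
    also have "\<dots> < e * n * (p ^ 5 * n)" using few by (simp add: n_def)
    finally show ?thesis using p n by simp
  qed
  have good: "\<exists>z. z \<in> X \<and> z \<notin> bad" if "e * n \<le> card X" for X
  proof (rule ccontr)
    assume "\<not> ?thesis"
    then have "X \<subseteq> bad" by auto
    then have "card X \<le> card bad" using V by (intro card_mono) (auto simp: bad_def)
    then show False using that bad by linarith
  qed
  \<comment> \<open>An edge \<open>uv\<close> outside \<open>M\<close> is closed up to the forbidden
    configuration. Good vertices \<open>z\<close> and \<open>z'\<close> have large codegree with
    \<open>u\<close> and \<open>v\<close> respectively and also with \<open>a\<close>. Edges
    \<open>zy\<close> and \<open>z'y'\<close> outside \<open>M\<close> are then sought with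
    \<open>y\<close>, \<open>y'\<close> in \<open>N a\<close> and of large codegree.\<close>
  have independent: False
    if a: "a \<in> V" "b \<in> V" "b \<in> N a" "b \<notin> M a" and uv: "u \<in> V" "v \<in> V" "u \<in> N v - M v"
      and u: "e * n \<le> card (S 4 u \<inter> S 4 a)" and v: "e * n \<le> card (S 4 v \<inter> S 4 a)" for a b u v
  proof -
    obtain z where z: "z \<in> S 4 u" "z \<in> S 4 a" "z \<notin> bad" using good[OF u] by auto
    obtain z' where z': "z' \<in> S 4 v" "z' \<in> S 4 a" "z' \<notin> bad" using good[OF v] by auto
    \<comment> \<open>\<open>S 17 b\<close> has at least (1/3 + 2e) n elements and shares fewer than
      e n with \<open>S 17 a\<close>, which leaves less than 2n/3 for the latter. Two large subsets
      of \<open>S 17 a\<close> must therefore meet.\<close>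
    have Sa: "card (S 17 a) < (2/3) * n"
    proof -
      have "(1/3 + 2 * e) * n \<le> card (S 17 b)"
      proof -
        have "card (S 4 b) \<le> card (S 17 b)"
          using V SV Smono[of 4 17 b] by (intro card_mono) (auto intro: finite_subset)
        then show ?thesis using S4[OF a(2)] by linarith
      qed
      moreover have "card (S 17 a \<inter> S 17 b) < e * n"
        using sparse[of b a] a by (simp add: n_def Int_commute)
      moreover have "card (S 17 a) + card (S 17 b) = card (S 17 a \<union> S 17 b) + card (S 17 a \<inter> S 17 b)"
        using V SV by (intro card_Un_Int) (auto intro: finite_subset)
      moreover have "card (S 17 a \<union> S 17 b) \<le> card V" using V SV by (intro card_mono) auto
      moreover have "0 < e * n" using e n by simp
      ultimately show ?thesis unfolding n_def by (simp add: algebra_simps)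
    qed
    \<comment> \<open>\<open>Q\<close> consists of the common neighbours of \<open>z\<close> and
      \<open>a\<close> joined to \<open>z\<close> outside \<open>M\<close>. As \<open>z\<close> is
      not bad and p <= 1/2, at least p^4 n - p^5 n >= p^5 n of them remain, and expansion from
      \<open>Q\<close> gives the exponent 7.\<close>
    have links: "\<exists>Q X. Q \<subseteq> N z - M z \<and> Q \<subseteq> N a \<and> X = {x \<in> V. p ^ 7 * n \<le> card (N x \<inter> Q)} \<and>
        (1/3 + 2 * e) * n \<le> card X \<and> X \<subseteq> S 17 a" if "z \<in> S 4 a" "z \<notin> bad" for z
    proof -
      define Q where "Q = (N z - M z) \<inter> N a"
      have fin: "finite (N x)" for x using N(2) V finite_subset by blast
      have "z \<in> V" using that by (simp add: S_def)
      have "p ^ 4 * n \<le> card (N z \<inter> N a)" using that by (auto simp: S_def n_def)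
      also have "card (N z \<inter> N a) \<le> card (Q \<union> M z)"
        using fin M(1) by (intro card_mono) (auto simp: Q_def intro: finite_subset)
      also have "\<dots> \<le> card Q + card (M z)" by (rule card_Un_le)
      finally have "p ^ 4 * n \<le> card Q + card (M z)" by simp
      moreover have "card (M z) < p ^ 5 * n" using that \<open>z \<in> V\<close> by (simp add: bad_def)
      moreover have "2 * p ^ 5 * n \<le> p ^ 4 * n"
        using p n by (simp add: power_numeral_reduce)
      ultimately have "p ^ 5 * n \<le> card Q" by linarith
      then have "(1/3 + 2 * e) * n \<le> card {x \<in> V. p ^ 7 * n \<le> card (N x \<inter> Q)}"
        using expand[of Q 5] N(2) by (auto simp: n_def Q_def)
      moreover have "{x \<in> V. p ^ 7 * n \<le> card (N x \<inter> Q)} \<subseteq> S 17 a"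
      proof -
        have "card (N x \<inter> Q) \<le> card (N x \<inter> N a)" for x
          using fin by (intro card_mono) (auto simp: Q_def)
        then have "real (card (N x \<inter> Q)) \<le> card (N x \<inter> N a)" for x by simp
        then have "{x \<in> V. p ^ 7 * n \<le> card (N x \<inter> Q)} \<subseteq> S 7 a"
          unfolding S_def n_def using order_trans by blast
        then show ?thesis using Smono[of 7 17 a] by simp
      qed
      ultimately show ?thesis
        by (intro exI[of _ Q] exI[of _ "{x \<in> V. p ^ 7 * n \<le> card (N x \<inter> Q)}"]) (auto simp: Q_def)
    qed
    obtain Q X where Q: "Q \<subseteq> N z - M z" "Q \<subseteq> N a" "X = {x \<in> V. p ^ 7 * n \<le> card (N x \<inter> Q)}"
        "(1/3 + 2 * e) * n \<le> card X" "X \<subseteq> S 17 a" using links[OF z(2,3)] by blast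
    obtain Q' X' where Q': "Q' \<subseteq> N z' - M z'" "Q' \<subseteq> N a" "X' = {x \<in> V. p ^ 7 * n \<le> card (N x \<inter> Q')}"
        "(1/3 + 2 * e) * n \<le> card X'" "X' \<subseteq> S 17 a" using links[OF z'(2,3)] by blast
    have XX: "4 * e * n \<le> card (X \<inter> X')"
      using large_sets_meet[of V X "S 17 a" X' e] Q Q' Sa SV V e by (simp add: n_def)
    \<comment> \<open>The exponent is 15 = 1 + 7 + 7: the intersection of \<open>X\<close> and
      \<open>X'\<close> has at least 4en >= pn points, each with p^7 n neighbours in
      \<open>Q\<close> and in \<open>Q'\<close>.\<close>
    have "\<exists>y\<in>Q. \<exists>y'\<in>Q'. p ^ 15 * n \<le> card {x \<in> V. x \<in> N y \<and> x \<in> N y'}"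
    proof (rule dense_bipartite_pairs[where a = "p ^ 7 * n" and Y = "X \<inter> X'"])
      show "Q \<subseteq> V" "Q' \<subseteq> V" using Q Q' N by blast+
      show "X \<inter> X' \<subseteq> V" using Q by auto
      have "0 < 4 * e * n" using e n by simp
      then show "X \<inter> X' \<noteq> {}" using XX by auto
      show "p ^ 15 * n * real (card V) ^ 2 \<le> card (X \<inter> X') * (p ^ 7 * n)\<^sup>2"
      proof -
        have "p ^ 15 * n * real (card V) ^ 2 = (p * n) * (p ^ 7 * n)\<^sup>2"
          by (simp add: n_def power2_eq_square power_numeral_reduce)
        also have "\<dots> \<le> card (X \<inter> X') * (p ^ 7 * n)\<^sup>2"
        proof (rule mult_right_mono)
          have "p * n \<le> 4 * e * n" using p n by (intro mult_right_mono) auto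
          then show "p * n \<le> card (X \<inter> X')" using XX by linarith
        qed simp
        finally show ?thesis .
      qed
    qed (use V N Q Q' p n in auto)
    then obtain y y' where y: "y \<in> Q" "y' \<in> Q'" "p ^ 15 * n \<le> card {x \<in> V. x \<in> N y \<and> x \<in> N y'}"
      by blast
    have "{x \<in> V. x \<in> N y \<and> x \<in> N y'} = N y \<inter> N y'" using N(2) by auto
    then have "p ^ 15 * n \<le> card (N y \<inter> N y')" using y(3) by simp
    moreover have "p ^ 15 * n \<le> card (N u \<inter> N z)" "p ^ 15 * n \<le> card (N v \<inter> N z')"
      using z(1) z'(1) pmono[of 4 15] by (auto simp: S_def n_def Int_commute)
    moreover have "z \<in> N y - M y" "z' \<in> N y' - M y'"
      using y(1,2) Q(1) Q'(1) N(1) M(2) by blast+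
    ultimately show False using nine_cycle uv(3) by blast
  qed
  define c where "c v = (if e * n \<le> card (S 4 v \<inter> S 4 a) then 0 else 1 :: nat)" for v
  \<comment> \<open>Among the three large sets \<open>S 4 v\<close>, \<open>S 4 a\<close>,
    \<open>S 4 b\<close>, the last two hardly meet because \<open>ab\<close> lies outside
    \<open>M\<close>. So a vertex not of colour 0 is tied to \<open>b\<close>, and the independence
    argument applies with \<open>a\<close> and \<open>b\<close> exchanged.\<close>
  have c1: "e * n \<le> card (S 4 v \<inter> S 4 b)" if "v \<in> V" "c v = 1" for v
  proof -
    have "card (S 4 a \<inter> S 4 b) \<le> card (S 17 a \<inter> S 17 b)"
      using V SV Smono[of 4 17 a] Smono[of 4 17 b] by (intro card_mono) (auto intro: finite_subset)
    moreover have "card (S 17 a \<inter> S 17 b) < e * n"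
      using sparse[of b a] ab by (simp add: n_def Int_commute)
    moreover have "card (S 4 v \<inter> S 4 a) < e * n" using that by (auto simp: c_def split: if_splits)
    moreover have "e * n < 2 * e * n" using e n by simp
    moreover have "2 * e * n \<le> card (S 4 v \<inter> S 4 a) \<or> 2 * e * n \<le> card (S 4 v \<inter> S 4 b) \<or>
        2 * e * n \<le> card (S 4 a \<inter> S 4 b)"
      unfolding n_def using V SV e S4[OF that(1)] S4[OF ab(1)] S4[OF ab(2)]
      by (intro three_large_sets_meet) (auto simp: n_def)
    ultimately show ?thesis by linarith
  qed
  have "c u \<noteq> c v" if uv: "u \<in> V" "v \<in> V" "u \<in> N v - M v" for u v
  proof
    assume eq: "c u = c v"
    show False
    proof (cases "c u = 0")
      case True
      then show False using independent[OF ab uv] eq by (auto simp: c_def split: if_splits)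
    next
      case False
      then have "c u = 1" "c v = 1" using eq by (auto simp: c_def split: if_splits)
      then have "e * n \<le> card (S 4 u \<inter> S 4 b)" "e * n \<le> card (S 4 v \<inter> S 4 b)"
        using c1 uv by auto
      moreover have "a \<in> N b" "a \<notin> M b" using ab N(1) M(2) by auto
      ultimately show False using independent[OF ab(2,1) _ _ uv] by blast
    qed
  qed
  moreover have "c v < 2" for v by (simp add: c_def)
  ultimately show ?thesis by blast
qed

section \<open>Upper uniformity of the random graph\<close>

text \<open>Markov's inequality for the exponential moment, which factorises by independence. On
  [0, 1] the estimate exp l <= 1 + l + l^2 turns each factor into exp (q (l + l^2)).\<close>

lemma bernoulli_product_chernoff:
  fixes q l a :: real
  assumes "finite A" "F \<subseteq> A" and q: "0 \<le> q" "q \<le> 1" and l: "0 \<le> l" "l \<le> 1"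
  shows "measure_pmf.prob (Pi_pmf A False (\<lambda>_. bernoulli_pmf q)) {X. a \<le> card {x \<in> F. X x}}
    \<le> exp (q * card F * (l + l\<^sup>2) - l * a)"
proof -
  let ?M = "Pi_pmf A False (\<lambda>_. bernoulli_pmf q)"
  define f where "f x b = (if x \<in> F \<and> b then exp l else 1)" for x b
  have finF: "finite F" using assms(1,2) finite_subset by blast
  have prod: "(\<Prod>x\<in>A. f x (X x)) = exp (l * card {x \<in> F. X x})" for X
  proof -
    have "(\<Prod>x\<in>A. f x (X x)) = (\<Prod>x\<in>{x \<in> F. X x}. exp l)"
      using assms(1,2) by (intro prod.mono_neutral_cong_right) (auto simp: f_def)
    then show ?thesis by (simp add: mult.commute flip: exp_of_nat_mult)
  qed
  have int: "integrable (measure_pmf (bernoulli_pmf q)) g" for g :: "bool \<Rightarrow> real"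
    by (rule integrable_measure_pmf_finite) simp
  have intM: "integrable (measure_pmf ?M) (\<lambda>X. \<Prod>x\<in>A. f x (X x))"
    using assms(1) int by (intro integrable_prod_Pi_pmf) auto
  have "measure_pmf.expectation ?M (\<lambda>X. \<Prod>x\<in>A. f x (X x)) =
      (\<Prod>x\<in>A. measure_pmf.expectation (bernoulli_pmf q) (f x))"
    using assms(1) int by (intro expectation_prod_Pi_pmf) (auto simp: f_def)
  also have "\<dots> = (\<Prod>x\<in>A. if x \<in> F then 1 + q * (exp l - 1) else 1)"
    using q by (intro prod.cong refl) (auto simp: f_def algebra_simps)
  also have "\<dots> = (1 + q * (exp l - 1)) ^ card F"
    using assms(1,2) by (simp add: prod.If_cases Int_absorb1)
  also have "\<dots> \<le> exp (q * (l + l\<^sup>2)) ^ card F"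
  proof (rule power_mono)
    have "exp l \<le> 1 + l + l\<^sup>2" using exp_bound[of l] l by simp
    then have "q * (exp l - 1) \<le> q * (l + l\<^sup>2)" using q by (intro mult_left_mono) auto
    then show "1 + q * (exp l - 1) \<le> exp (q * (l + l\<^sup>2))"
      using exp_ge_add_one_self[of "q * (l + l\<^sup>2)"] by linarith
    show "0 \<le> 1 + q * (exp l - 1)" using q l by simp
  qed
  also have "\<dots> = exp (q * card F * (l + l\<^sup>2))" by (simp add: mult_ac flip: exp_of_nat_mult)
  finally have E: "measure_pmf.expectation ?M (\<lambda>X. \<Prod>x\<in>A. f x (X x)) \<le> exp (q * card F * (l + l\<^sup>2))" .
  have "measure_pmf.prob ?M {X. a \<le> card {x \<in> F. X x}}
      \<le> measure_pmf.prob ?M {X. exp (l * a) \<le> (\<Prod>x\<in>A. f x (X x))}"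
    unfolding prod using l by (intro measure_pmf.finite_measure_mono) (auto intro: mult_left_mono)
  also have "\<dots> \<le> measure_pmf.expectation ?M (\<lambda>X. \<Prod>x\<in>A. f x (X x)) / exp (l * a)"
    using integral_Markov_inequality_measure[OF intM, of "{}" "exp (l * a)"]
    by (simp add: prod_nonneg f_def)
  also have "\<dots> \<le> exp (q * card F * (l + l\<^sup>2)) / exp (l * a)"
    using E by (intro divide_right_mono) auto
  also have "\<dots> = exp (q * card F * (l + l\<^sup>2) - l * a)" by (simp add: exp_diff)
  finally show ?thesis .
qed

text \<open>The term \<open>d * n\<close> makes a lower bound on \<open>card B\<close> unnecessary. Any fixed exponent in place
  of 15 would do; 15 is the largest one at which \<open>bipartite_remainder\<close> applies its expansion hypothesis.\<close>

definition upper_uniform :: "real \<Rightarrow> real \<Rightarrow> nat \<Rightarrow> nat pair_pre_digraph \<Rightarrow> bool" where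
  "upper_uniform d q n \<Gamma> \<longleftrightarrow> pverts \<Gamma> = {..<n} \<and>
     (\<forall>A\<subseteq>{..<n}. \<forall>B\<subseteq>{..<n}. A \<inter> B = {} \<longrightarrow> q ^ 15 * real n \<le> real (card A) \<longrightarrow>
       real (card (parcs \<Gamma> \<inter> A \<times> B)) \<le> q * real (card A) * (real (card B) + d * real n))"

lemma finite_vertex_pairs: "finite (vertex_pairs n)"
  by (rule finite_subset[of _ "Pow {..<n}"]) (auto simp: vertex_pairs_def)

text \<open>A union bound over at most 4^n pairs of vertex sets, with a Chernoff bound for each
  pair.\<close>

lemma prob_not_upper_uniform:
  assumes d: "0 \<le> d" "d \<le> 1" and q: "0 \<le> q" "q \<le> 1"
  shows "measure_pmf.prob (binomial_random_graph n q) {\<Gamma>. \<not> upper_uniform d q n \<Gamma>}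
    \<le> 4 ^ n * exp (- (q ^ 16 * real n ^ 2 * d\<^sup>2 / 4))"
proof -
  let ?M = "Pi_pmf (vertex_pairs n) False (\<lambda>_. bernoulli_pmf q)"
  define T where "T = {(A, B). A \<subseteq> {..<n} \<and> B \<subseteq> {..<n} \<and> A \<inter> B = {} \<and> q ^ 15 * n \<le> card A}"
  define F where "F A B = (\<lambda>(x, y). {x, y}) ` (A \<times> B)" for A B :: "nat set"
  define bad where "bad A B = {X. q * card A * (card B + d * n) \<le> real (card {e \<in> F A B. X e})}" for A B
  have T: "T \<subseteq> Pow {..<n} \<times> Pow {..<n}" by (auto simp: T_def)
  have finT: "finite T" by (rule finite_subset[OF T]) simp
  have "card T \<le> card (Pow {..<n} \<times> Pow {..<n})" using T by (intro card_mono) auto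
  also have "\<dots> = 4 ^ n" by (simp add: card_cartesian_product card_Pow flip: power_mult_distrib)
  finally have cT: "card T \<le> 4 ^ n" .
  have sub: "{X. \<not> upper_uniform d q n \<lparr>pverts = {..<n}, parcs = {(u, v). {u, v} \<in> vertex_pairs n \<and> X {u, v}}\<rparr>}
      \<subseteq> (\<Union>(A, B)\<in>T. bad A B)"
  proof
    fix X assume "X \<in> {X. \<not> upper_uniform d q n \<lparr>pverts = {..<n}, parcs = {(u, v). {u, v} \<in> vertex_pairs n \<and> X {u, v}}\<rparr>}"
    then obtain A B where AB: "A \<subseteq> {..<n}" "B \<subseteq> {..<n}" "A \<inter> B = {}" "q ^ 15 * n \<le> card A"
      "q * card A * (card B + d * n) < card ({(u, v). {u, v} \<in> vertex_pairs n \<and> X {u, v}} \<inter> A \<times> B)"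
      by (auto simp: upper_uniform_def not_le)
    have fin: "finite A" "finite B" using AB finite_subset by blast+
    \<comment> \<open>Disjointness of \<open>A\<close> and \<open>B\<close> ensures that distinct
      arcs from \<open>A\<close> to \<open>B\<close> come from distinct edges, that is, from
      distinct independent coin flips.\<close>
    have "card ({(u, v). {u, v} \<in> vertex_pairs n \<and> X {u, v}} \<inter> A \<times> B) =
        card ((\<lambda>(x, y). {x, y}) ` ({(u, v). {u, v} \<in> vertex_pairs n \<and> X {u, v}} \<inter> A \<times> B))"
      using AB(3) by (intro card_image[symmetric]) (auto simp: inj_on_def doubleton_eq_iff)
    also have "\<dots> \<le> card {e \<in> F A B. X e}"
      using fin by (intro card_mono) (auto simp: F_def)
    finally have "X \<in> bad A B" using AB(5) by (simp add: bad_def)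
    then show "X \<in> (\<Union>(A, B)\<in>T. bad A B)" using AB by (auto simp: T_def)
  qed
  have bound: "measure_pmf.prob ?M (bad A B) \<le> exp (- (q ^ 16 * real n ^ 2 * d\<^sup>2 / 4))"
    if "(A, B) \<in> T" for A B
  proof -
    have AB: "A \<subseteq> {..<n}" "B \<subseteq> {..<n}" "A \<inter> B = {}" "q ^ 15 * n \<le> card A" using that by (auto simp: T_def)
    have "{x, y} \<in> vertex_pairs n" if "x \<in> A" "y \<in> B" for x y
    proof -
      have "x \<noteq> y" using that AB by auto
      then show ?thesis using that AB by (auto simp: vertex_pairs_def)
    qed
    then have FV: "F A B \<subseteq> vertex_pairs n" by (auto simp: F_def)
    have cF: "card (F A B) = card A * card B"
      unfolding F_def using AB(3)
      by (subst card_image) (auto simp: inj_on_def doubleton_eq_iff card_cartesian_product)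
    \<comment> \<open>The Chernoff parameter is l = d/2: the linear terms in |A| |B| cancel, and the
      quadratic one is at most half of the gain from the slack d n, since |B| <= n.\<close>
    have "measure_pmf.prob ?M (bad A B) \<le> exp (q * card (F A B) * (d / 2 + (d / 2)\<^sup>2) -
        d / 2 * (q * card A * (card B + d * n)))"
      unfolding bad_def using finite_vertex_pairs FV q d by (intro bernoulli_product_chernoff) auto
    also have "q * card (F A B) * (d / 2 + (d / 2)\<^sup>2) - d / 2 * (q * card A * (card B + d * n))
        = q * card A * (d\<^sup>2 / 4) * card B - q * card A * (d\<^sup>2 / 2) * n"
      unfolding cF by (simp add: algebra_simps power2_eq_square)
    also have "\<dots> \<le> - (q * card A * (d\<^sup>2 / 4) * n)"
    proof -
      have "card B \<le> n" using card_mono[of "{..<n}" B] AB by simp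
      then have "q * card A * (d\<^sup>2 / 4) * card B \<le> q * card A * (d\<^sup>2 / 4) * n"
        using q by (intro mult_left_mono) auto
      then show ?thesis by (simp add: algebra_simps)
    qed
    also have "\<dots> \<le> - (q ^ 16 * real n ^ 2 * d\<^sup>2 / 4)"
    proof -
      have "q * (q ^ 15 * n) * (d\<^sup>2 / 4) * n \<le> q * card A * (d\<^sup>2 / 4) * n"
        using AB(4) q by (intro mult_right_mono mult_left_mono) auto
      then show ?thesis by (simp add: power2_eq_square power_numeral_reduce mult_ac)
    qed
    finally show ?thesis by simp
  qed
  have "measure_pmf.prob (binomial_random_graph n q) {\<Gamma>. \<not> upper_uniform d q n \<Gamma>} =
      measure_pmf.prob ?M {X. \<not> upper_uniform d q n \<lparr>pverts = {..<n}, parcs = {(u, v). {u, v} \<in> vertex_pairs n \<and> X {u, v}}\<rparr>}"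
    by (simp add: binomial_random_graph_def vimage_def)
  also have "\<dots> \<le> measure_pmf.prob ?M (\<Union>(A, B)\<in>T. bad A B)"
    using sub by (intro measure_pmf.finite_measure_mono) auto
  also have "\<dots> \<le> (\<Sum>(A, B)\<in>T. measure_pmf.prob ?M (bad A B))"
    using measure_pmf.finite_measure_subadditive_finite[OF finT, of "\<lambda>(A, B). bad A B" ?M]
    by (simp add: case_prod_unfold)
  also have "\<dots> \<le> (\<Sum>(A, B)\<in>T. exp (- (q ^ 16 * real n ^ 2 * d\<^sup>2 / 4)))"
    using bound by (intro sum_mono) auto
  also have "\<dots> = card T * exp (- (q ^ 16 * real n ^ 2 * d\<^sup>2 / 4))" by simp
  also have "\<dots> \<le> 4 ^ n * exp (- (q ^ 16 * real n ^ 2 * d\<^sup>2 / 4))"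
    using of_nat_mono[OF cT, where 'a = real] by (intro mult_right_mono) auto
  finally show ?thesis .
qed

section \<open>Asymptotics for p(n) and high probability\<close>

text \<open>Eventually p(n) >= n^(-1/(2k+1)), hence p^k n >= sqrt n. The denominator 2k + 1 rather
  than 2k covers k = 0.\<close>

lemma power_times_nat_at_top:
  assumes "n_to_minus_o1 p" and "\<And>n. p n \<le> 1"
  shows "filterlim (\<lambda>n. p n ^ k * real n) at_top sequentially"
proof (rule filterlim_at_top_mono)
  show "filterlim (\<lambda>n. sqrt (real n)) at_top sequentially"
    by (rule filterlim_compose[OF sqrt_at_top filterlim_real_sequentially])
  have pos: "\<forall>\<^sub>F n in sequentially. 0 < p n"
    and lim: "(\<lambda>n. ln (1 / p n) / ln (real n)) \<longlonglongrightarrow> 0"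
    using assms(1) by (auto simp: n_to_minus_o1_def)
  have "\<forall>\<^sub>F n in sequentially. ln (1 / p n) / ln (real n) < 1 / (2 * real k + 1)"
    using lim by (rule order_tendstoD) simp
  then show "\<forall>\<^sub>F n in sequentially. sqrt (real n) \<le> p n ^ k * real n"
    using pos eventually_gt_at_top[of 1]
  proof eventually_elim
    case (elim n)
    have ln: "0 < ln (real n)" using elim by simp
    then have "ln (1 / p n) * (2 * real k + 1) \<le> ln (real n)"
      using elim(1) by (simp add: field_simps)
    moreover have "ln (1 / p n) = - ln (p n)" "ln (p n) \<le> 0"
      using elim(2) assms(2)[of n] by (simp_all add: ln_div)
    ultimately have "ln (real n) / 2 \<le> k * ln (p n) + ln (real n)" by (simp add: algebra_simps)
    then have "exp (ln (real n) / 2) \<le> exp (k * ln (p n) + ln (real n))" by simp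
    moreover have "exp (k * ln (p n) + ln (real n)) = p n ^ k * real n"
      using elim by (simp add: exp_add exp_of_nat_mult)
    moreover have "exp (ln (real n) / 2) = sqrt (real n)"
      using elim by (simp flip: ln_sqrt)
    ultimately show ?case by simp
  qed
qed

lemma upper_uniform_whp:
  assumes p: "\<And>n. 0 \<le> p n \<and> p n \<le> 1" "n_to_minus_o1 p" and d: "0 < d" "d \<le> 1"
  shows "with_high_probability (\<lambda>n. binomial_random_graph n (p n)) (\<lambda>n. upper_uniform d (p n) n)"
  unfolding with_high_probability_def
proof (rule tendsto_sandwich)
  have "filterlim (\<lambda>n. p n ^ 16 * real n) at_top sequentially"
    using p by (intro power_times_nat_at_top) auto
  \<comment> \<open>With this constant the exponent p^16 n^2 d^2 / 4 is at least n ln 4 + n, so it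
    absorbs 4^n and leaves exp (-n).\<close>
  then have "\<forall>\<^sub>F n in sequentially. (ln 4 + 1) * 4 / d\<^sup>2 \<le> p n ^ 16 * real n"
    by (simp add: filterlim_at_top)
  then show "\<forall>\<^sub>F n in sequentially. 1 - exp (- real n) \<le>
      measure_pmf.prob (binomial_random_graph n (p n)) {\<Gamma>. upper_uniform d (p n) n \<Gamma>}"
  proof eventually_elim
    case (elim n)
    let ?M = "binomial_random_graph n (p n)"
    have "measure_pmf.prob ?M {\<Gamma>. \<not> upper_uniform d (p n) n \<Gamma>}
        \<le> 4 ^ n * exp (- (p n ^ 16 * real n ^ 2 * d\<^sup>2 / 4))"
      using p d by (intro prob_not_upper_uniform) auto
    also have "\<dots> = exp (n * ln 4 - p n ^ 16 * real n ^ 2 * d\<^sup>2 / 4)"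
    proof -
      have "exp (n * ln 4) = (4 :: real) ^ n" by (simp add: exp_of_nat_mult)
      then show ?thesis
        using exp_add[of "n * ln 4" "- (p n ^ 16 * real n ^ 2 * d\<^sup>2 / 4)"] by simp
    qed
    also have "\<dots> \<le> exp (- real n)"
    proof -
      have "ln 4 + 1 \<le> p n ^ 16 * real n * (d\<^sup>2 / 4)" using elim d by (simp add: field_simps)
      then have "(ln 4 + 1) * n \<le> p n ^ 16 * real n * (d\<^sup>2 / 4) * n" by (intro mult_right_mono) auto
      then show ?thesis by (simp add: algebra_simps power2_eq_square)
    qed
    finally have "measure_pmf.prob ?M {\<Gamma>. \<not> upper_uniform d (p n) n \<Gamma>} \<le> exp (- real n)" .
    moreover have "measure_pmf.prob ?M {\<Gamma>. \<not> upper_uniform d (p n) n \<Gamma>} =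
        1 - measure_pmf.prob ?M {\<Gamma>. upper_uniform d (p n) n \<Gamma>}"
    proof -
      have "{\<Gamma>. \<not> upper_uniform d (p n) n \<Gamma>} = space (measure_pmf ?M) - {\<Gamma>. upper_uniform d (p n) n \<Gamma>}"
        by auto
      then show ?thesis using measure_pmf.prob_compl[of "{\<Gamma>. upper_uniform d (p n) n \<Gamma>}" ?M] by simp
    qed
    ultimately show ?case by simp
  qed
  show "\<forall>\<^sub>F n in sequentially. measure_pmf.prob (binomial_random_graph n (p n))
      {\<Gamma>. upper_uniform d (p n) n \<Gamma>} \<le> 1" by simp
  have "(\<lambda>n. exp (- real n)) \<longlonglongrightarrow> 0"
    by (rule filterlim_compose[OF exp_at_bot])
       (rule filterlim_compose[OF filterlim_uminus_at_bot_at_top filterlim_real_sequentially])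
  then show "(\<lambda>n. 1 - exp (- real n)) \<longlonglongrightarrow> 1" using tendsto_diff[OF tendsto_const] by fastforce
qed simp

lemma with_high_probability_mono:
  assumes "with_high_probability M P" and "\<forall>\<^sub>F n in sequentially. \<forall>x. P n x \<longrightarrow> Q n x"
  shows "with_high_probability M Q"
  unfolding with_high_probability_def
proof (rule tendsto_sandwich)
  show "(\<lambda>n. measure_pmf.prob (M n) {x. P n x}) \<longlonglongrightarrow> 1"
    using assms(1) by (simp add: with_high_probability_def)
  show "\<forall>\<^sub>F n in sequentially. measure_pmf.prob (M n) {x. P n x} \<le> measure_pmf.prob (M n) {x. Q n x}"
    using assms(2)
  proof eventually_elim
    case (elim n)
    then show ?case by (intro measure_pmf.finite_measure_mono) auto
  qed
  show "\<forall>\<^sub>F n in sequentially. measure_pmf.prob (M n) {x. Q n x} \<le> 1" by simp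
qed simp

section \<open>Cloud-forest graphs\<close>

text \<open>Peel off a vertex with at most one neighbour in the remaining set, and give it the
  largest label and that neighbour as parent. Labels start at 1: the free label 0 is an additional
  root joining the components to one tree, as the tree embedding expects.\<close>

lemma forest_labelling:
  assumes "finite L"
    and sym: "\<And>x y. (x, y) \<in> E \<Longrightarrow> (y, x) \<in> E" and irr: "\<And>x. (x, x) \<notin> E"
    and leaf: "\<And>U. U \<subseteq> L \<Longrightarrow> U \<noteq> {} \<Longrightarrow> \<exists>v\<in>U. \<exists>p. \<forall>w\<in>U. (v, w) \<in> E \<longrightarrow> w = p"
  shows "\<exists>lab par. inj_on lab L \<and> lab ` L \<subseteq> {1..card L} \<and> (\<forall>i\<in>{1..card L}. par i < i) \<and>
    (\<forall>x\<in>L. \<forall>y\<in>L. (x, y) \<in> E \<longrightarrow> par (lab x) = lab y \<or> par (lab y) = (lab x :: nat))"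
  using assms(1) leaf
proof (induction L rule: finite_psubset_induct)
  case (psubset L)
  show ?case
  proof (cases "L = {}")
    case False
    then obtain v p where v: "v \<in> L" "\<And>w. w \<in> L \<Longrightarrow> (v, w) \<in> E \<Longrightarrow> w = p"
      using psubset.prems[of L] by blast
    have "\<exists>lab par. inj_on lab (L - {v}) \<and> lab ` (L - {v}) \<subseteq> {1..card (L - {v})} \<and>
        (\<forall>i\<in>{1..card (L - {v})}. par i < i) \<and>
        (\<forall>x\<in>L - {v}. \<forall>y\<in>L - {v}. (x, y) \<in> E \<longrightarrow> par (lab x) = lab y \<or> par (lab y) = (lab x :: nat))"
      using v(1) by (intro psubset.IH psubset.prems) auto
    then obtain lab par where lp: "inj_on lab (L - {v})" "lab ` (L - {v}) \<subseteq> {1..card (L - {v})}"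
        "\<forall>i\<in>{1..card (L - {v})}. par i < i"
        "\<forall>x\<in>L - {v}. \<forall>y\<in>L - {v}. (x, y) \<in> E \<longrightarrow> par (lab x) = lab y \<or> par (lab y) = (lab x :: nat)"
      by blast
    define l where "l = card L"
    have l: "l = Suc (card (L - {v}))" unfolding l_def using v psubset.hyps by (metis card.remove)
    have labl: "lab x < l" "1 \<le> lab x" if "x \<in> L - {v}" for x
      using lp(2) that unfolding l by (auto simp: image_subset_iff less_Suc_eq_le)
    define lab' where "lab' = lab(v := l)"
    define par' where "par' = par(l := if p \<in> L - {v} then lab p else 0)"
    have "inj_on lab' L"
      using lp(1) labl by (fastforce simp: inj_on_def lab'_def)
    moreover have "lab' ` L \<subseteq> {1..l}"
      using labl by (force simp: lab'_def l)
    moreover have "\<forall>i\<in>{1..l}. par' i < i"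
      using lp(3) l labl by (auto simp: par'_def)
    moreover have "par' (lab' x) = lab' y \<or> par' (lab' y) = lab' x"
      if xy: "x \<in> L" "y \<in> L" "(x, y) \<in> E" for x y
    proof -
      have ne: "x \<noteq> y" using irr xy by auto
      consider "x = v" | "y = v" | "x \<noteq> v" "y \<noteq> v" by blast
      then show ?thesis
      proof cases
        case 1
        then have "y = p" "y \<noteq> v" using v(2)[of y] xy ne by auto
        then show ?thesis using 1 xy by (simp add: lab'_def par'_def)
      next
        case 2
        then have "x = p" "x \<noteq> v" using v(2)[of x] xy ne sym by auto
        then show ?thesis using 2 xy by (simp add: lab'_def par'_def)
      next
        case 3
        then show ?thesis using lp(4) xy labl[of x] labl[of y] by (auto simp: lab'_def par'_def)
      qed
    qed
    ultimately show ?thesis unfolding l_def by blast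
  qed simp
qed

lemma cas_zip:
  assumes "tail F = fst" "head F = snd" "ys \<noteq> []"
  shows "pre_digraph.cas F (hd ys) (zip ys (tl ys @ [z])) z"
  using assms(3)
proof (induction ys)
  case (Cons y ys)
  then show ?case
    using assms(1,2) by (cases ys) (simp_all add: pre_digraph.cas.simps)
qed simp

text \<open>A closed walk is encoded by zipping its vertex list with the rotated list; the visited
  vertices are then \<open>ys @ [hd ys]\<close>, whose tail is distinct.\<close>

lemma cycle_zip:
  assumes F: "tail F = fst" "head F = snd" and ys: "ys \<noteq> []" "distinct ys"
    and arcs: "set (zip ys (tl ys @ [hd ys])) \<subseteq> arcs F" and v: "hd ys \<in> verts F"
  shows "pre_digraph.cycle F (zip ys (tl ys @ [hd ys]))"
proof -
  let ?p = "zip ys (tl ys @ [hd ys])"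
  have len: "length (tl ys @ [hd ys]) = length ys" using ys by (cases ys) auto
  then have p: "?p \<noteq> []" using ys by (metis length_0_conv length_zip min.idem)
  have "map (tail F) ?p = ys" using len F by simp
  moreover have "head F (last ?p) = hd ys"
  proof -
    have "last ?p = (last ys, last (tl ys @ [hd ys]))"
      using len ys by (intro last_zip) auto
    then show ?thesis using F by simp
  qed
  ultimately have "pre_digraph.awalk_verts F (hd ys) ?p = ys @ [hd ys]"
    using p by (simp add: pre_digraph.awalk_verts_conv)
  then have "distinct (tl (pre_digraph.awalk_verts F (hd ys) ?p))" using ys by (cases ys) auto
  then show ?thesis
    unfolding pre_digraph.cycle_def pre_digraph.awalk_def
    using p arcs v cas_zip[OF F ys(1)] by (intro exI[of _ "hd ys"]) auto
qed

text \<open>Take a longest path in \<open>U\<close>. By maximality all neighbours in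
  \<open>U\<close> of its first vertex lie on the path. Two of them would include one at position at
  least 2, and the edge to it closes a cycle of length at least 3.\<close>

lemma undirected_forest_leaf:
  assumes F: "tail F = fst" "head F = snd" and forest: "undirected_forest F"
    and sym: "\<And>x y. (x, y) \<in> arcs F \<Longrightarrow> (y, x) \<in> arcs F" and irr: "\<And>x. (x, x) \<notin> arcs F"
    and U: "finite U" "U \<noteq> {}" "U \<subseteq> verts F"
  shows "\<exists>v\<in>U. \<exists>p. \<forall>w\<in>U. (v, w) \<in> arcs F \<longrightarrow> w = p"
proof (rule ccontr)
  assume contr: "\<not> ?thesis"
  define path where "path xs \<longleftrightarrow> xs \<noteq> [] \<and> distinct xs \<and> set xs \<subseteq> U \<and>
    (\<forall>i. Suc i < length xs \<longrightarrow> (xs ! i, xs ! Suc i) \<in> arcs F)" for xs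
  obtain u where "u \<in> U" using U by blast
  then have "path [u]" by (simp add: path_def)
  moreover have "\<forall>xs. path xs \<longrightarrow> length xs < Suc (card U)"
    using U(1) by (auto simp: path_def less_Suc_eq_le simp flip: distinct_card intro!: card_mono)
  ultimately obtain xs where xs: "path xs" "\<And>ys. path ys \<Longrightarrow> length ys \<le> length xs"
    using ex_has_greatest_nat[of path "[u]" length "Suc (card U)"] by blast
  define x where "x = hd xs"
  have x: "x = xs ! 0" "x \<in> U" using xs(1) by (auto simp: path_def x_def hd_conv_nth)
  have inxs: "w \<in> set xs" if "w \<in> U" "(x, w) \<in> arcs F" for w
  proof (rule ccontr)
    assume "w \<notin> set xs"
    have "((w # xs) ! i, (w # xs) ! Suc i) \<in> arcs F" if "Suc i < length (w # xs)" for i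
      using that \<open>(x, w) \<in> arcs F\<close> sym xs(1) x by (cases i) (auto simp: path_def)
    then have "path (w # xs)"
      using \<open>w \<notin> set xs\<close> \<open>w \<in> U\<close> xs(1) by (auto simp: path_def)
    then show False using xs(2)[of "w # xs"] by simp
  qed
  obtain w1 where w1: "w1 \<in> U" "(x, w1) \<in> arcs F" using contr x(2) by blast
  obtain w2 where w2: "w2 \<in> U" "(x, w2) \<in> arcs F" "w2 \<noteq> w1" using contr x(2) by blast
  obtain i where i: "i < length xs" "xs ! i = w1" using inxs[OF w1] by (auto simp: in_set_conv_nth)
  obtain j where j: "j < length xs" "xs ! j = w2" using inxs[OF w2(1,2)] by (auto simp: in_set_conv_nth)
  have "i \<noteq> 0" "j \<noteq> 0" using i j x w1 w2 irr by metis+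
  moreover have "i \<noteq> j" using i j w2 by auto
  ultimately have "2 \<le> i \<or> 2 \<le> j" by linarith
  then obtain k where k: "k < length xs" "2 \<le> k" "(x, xs ! k) \<in> arcs F"
    using i j w1 w2 by blast
  define ys where "ys = take (Suc k) xs"
  have ys: "length ys = Suc k" "distinct ys" "hd ys = x" "ys \<noteq> []"
    using k xs(1) by (auto simp: ys_def path_def x_def)
  have "set (zip ys (tl ys @ [hd ys])) \<subseteq> arcs F"
  proof
    fix a assume "a \<in> set (zip ys (tl ys @ [hd ys]))"
    then obtain m where m: "m < length ys" "a = (ys ! m, (tl ys @ [hd ys]) ! m)"
      by (auto simp: set_zip)
    show "a \<in> arcs F"
    proof (cases "m < k")
      case True
      then have "a = (xs ! m, xs ! Suc m)" using m ys(1) k by (auto simp: nth_append nth_tl ys_def)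
      then show ?thesis using True k xs(1) by (auto simp: path_def)
    next
      case False
      then have "m = k" using m ys(1) by simp
      then have "a = (xs ! k, x)" using m ys k by (auto simp: nth_append ys_def)
      then show ?thesis using k sym by simp
    qed
  qed
  then have "pre_digraph.cycle F (zip ys (tl ys @ [hd ys]))"
    using ys x U by (intro cycle_zip F) auto
  moreover have "3 \<le> length (zip ys (tl ys @ [hd ys]))" using ys k by simp
  ultimately show False using forest by (auto simp: undirected_forest_def)
qed

text \<open>This is the partition form of the definition: \<open>J\<close> collects the vertices
  outside the cloud that send edges to it, \<open>L\<close> is the remaining forest, and
  \<open>att\<close> records the unique neighbour in \<open>L\<close>, if any, of a vertex of
  \<open>J\<close>.\<close>

lemma cloud_forest_structure:
  assumes "pair_graph H" "cloud_forest H"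
  obtains I J L :: "'a set" and lab att par :: "_ \<Rightarrow> nat" and t where
    "pverts H = I \<union> J \<union> L" "I \<inter> J = {}" "I \<inter> L = {}" "J \<inter> L = {}"
    "inj_on lab L" "lab ` L \<subseteq> {..t}" "att ` J \<subseteq> {..t}"
    "\<And>i. 1 \<le> i \<Longrightarrow> i \<le> t \<Longrightarrow> par i < i"
    "\<And>x y. (x, y) \<in> parcs H \<Longrightarrow> x \<in> I \<and> y \<in> J \<or> x \<in> J \<and> y \<in> I \<or>
      x \<in> J \<and> y \<in> L \<and> att x = lab y \<or> x \<in> L \<and> y \<in> J \<and> att y = lab x \<or>
      x \<in> L \<and> y \<in> L \<and> (1 \<le> lab x \<and> par (lab x) = lab y \<or> 1 \<le> lab y \<and> par (lab y) = lab x)"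
proof -
  interpret H: pair_graph H by fact
  obtain I where I: "independent_set H I"
    and cf: "let F = with_proj H \<restriction> (pverts H - I);
             leaf = (\<lambda>v. v \<in> verts F \<and> out_degree F v = 1);
             isolated = (\<lambda>v. v \<in> verts F \<and> out_degree F v = 0);
             sends = (\<lambda>v. \<exists>u\<in>I. (v, u) \<in> parcs H)
         in undirected_forest F \<and>
            (\<forall>v\<in>verts F. sends v \<longrightarrow> leaf v \<or> isolated v) \<and>
            (\<forall>(v, w)\<in>arcs F. leaf v \<and> leaf w \<longrightarrow> \<not> (sends v \<and> sends w))"
    using assms(2) unfolding cloud_forest_def by blast
  define F where "F = with_proj H \<restriction> (pverts H - I)"
  define sends where "sends v \<longleftrightarrow> (\<exists>u\<in>I. (v, u) \<in> parcs H)" for v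
  have F: "tail F = fst" "head F = snd" "verts F = pverts H - I"
    "arcs F = {(x, y) \<in> parcs H. x \<in> pverts H - I \<and> y \<in> pverts H - I}"
    by (auto simp: F_def)
  have forest: "undirected_forest F"
    and leaf: "\<And>v. v \<in> verts F \<Longrightarrow> sends v \<Longrightarrow> out_degree F v = 1 \<or> out_degree F v = 0"
    and nonadj: "\<And>v w. (v, w) \<in> arcs F \<Longrightarrow> out_degree F v = 1 \<Longrightarrow> out_degree F w = 1 \<Longrightarrow>
      \<not> (sends v \<and> sends w)"
    using cf unfolding Let_def F_def[symmetric] sends_def[symmetric]
    by (auto simp: F(3,4))
  have sym: "(y, x) \<in> parcs H" if "(x, y) \<in> parcs H" for x y using that by (rule H.arcs_symmetric)
  have irr: "(x, x) \<notin> parcs H" for x using H.no_loops' by blast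
  have symF: "(y, x) \<in> arcs F" if "(x, y) \<in> arcs F" for x y using that sym by (auto simp: F)
  have irrF: "(x, x) \<notin> arcs F" for x using irr by (auto simp: F)
  have finF: "finite (arcs F)" using H.pair_finite_arcs by (rule rev_finite_subset) (auto simp: F)
  have unique: "w = w'" if "v \<in> verts F" "sends v" "(v, w) \<in> arcs F" "(v, w') \<in> arcs F" for v w w'
  proof (rule ccontr)
    assume "w \<noteq> w'"
    then have "card {(v, w), (v, w')} = 2" by simp
    moreover have "card {(v, w), (v, w')} \<le> out_degree F v"
      unfolding out_degree_def using finF that F by (intro card_mono) (auto simp: out_arcs_def)
    ultimately show False using leaf[OF that(1,2)] by auto
  qed
  define J where "J = {v \<in> pverts H - I. sends v}"
  define L where "L = pverts H - I - J"
  have IH: "I \<subseteq> pverts H" "\<And>u v. u \<in> I \<Longrightarrow> v \<in> I \<Longrightarrow> (u, v) \<notin> parcs H"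
    using I by (auto simp: independent_set_def)
  have finL: "finite L" using H.pair_finite_verts by (simp add: L_def)
  have "\<exists>lab par. inj_on lab L \<and> lab ` L \<subseteq> {1..card L} \<and> (\<forall>i\<in>{1..card L}. par i < i) \<and>
    (\<forall>x\<in>L. \<forall>y\<in>L. (x, y) \<in> arcs F \<longrightarrow> par (lab x) = lab y \<or> par (lab y) = (lab x :: nat))"
  proof (rule forest_labelling[OF finL symF irrF])
    fix U assume U: "U \<subseteq> L" "U \<noteq> {}"
    then have "finite U" using finL finite_subset by blast
    then show "\<exists>v\<in>U. \<exists>p. \<forall>w\<in>U. (v, w) \<in> arcs F \<longrightarrow> w = p"
      using U by (intro undirected_forest_leaf[OF F(1,2) forest symF irrF]) (auto simp: F(3) L_def)
  qed
  then obtain lab par where lab: "inj_on lab L" "lab ` L \<subseteq> {1..card L}"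
    "\<forall>i\<in>{1..card L}. par i < i"
    "\<forall>x\<in>L. \<forall>y\<in>L. (x, y) \<in> arcs F \<longrightarrow> par (lab x) = lab y \<or> par (lab y) = (lab x :: nat)"
    by blast
  define att where "att j = (if \<exists>y\<in>L. (j, y) \<in> arcs F then lab (SOME y. y \<in> L \<and> (j, y) \<in> arcs F) else 0)" for j
  have att: "att j = lab y" if "j \<in> J" "y \<in> L" "(j, y) \<in> arcs F" for j y
  proof -
    have "(SOME y. y \<in> L \<and> (j, y) \<in> arcs F) = y"
      using that unique[of j] by (intro some_equality) (auto simp: J_def F)
    then show ?thesis using that by (auto simp: att_def)
  qed
  have attJ: "att ` J \<subseteq> {..card L}"
  proof
    fix i assume "i \<in> att ` J"
    then obtain j where j: "j \<in> J" "i = att j" by blast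
    show "i \<in> {..card L}"
    proof (cases "\<exists>y\<in>L. (j, y) \<in> arcs F")
      case True
      then obtain y where "y \<in> L" "(j, y) \<in> arcs F" by blast
      then have "i = lab y" using att j by simp
      then show ?thesis using lab(2) \<open>y \<in> L\<close> by auto
    qed (simp add: att_def j)
  qed
  \<comment> \<open>Two adjacent vertices of \<open>J\<close> have positive degree in
    \<open>F\<close>, so both are leaves that send edges to the cloud.\<close>
  have JJ: False if "(x, y) \<in> parcs H" "x \<in> J" "y \<in> J" for x y
  proof -
    have xy: "(x, y) \<in> arcs F" "(y, x) \<in> arcs F" using that sym by (auto simp: F J_def)
    have nz: "out_degree F v \<noteq> 0" if "(v, w) \<in> arcs F" for v w
      using that finF F by (auto simp: out_degree_def out_arcs_def)
    then have "out_degree F x = 1" "out_degree F y = 1"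
      using leaf[of x] leaf[of y] nz[OF xy(1)] nz[OF xy(2)] that by (auto simp: J_def F(3))
    then show False using nonadj[OF xy(1)] that by (auto simp: J_def)
  qed
  have arcs: "x \<in> I \<and> y \<in> J \<or> x \<in> J \<and> y \<in> I \<or>
      x \<in> J \<and> y \<in> L \<and> att x = lab y \<or> x \<in> L \<and> y \<in> J \<and> att y = lab x \<or>
      x \<in> L \<and> y \<in> L \<and> (1 \<le> lab x \<and> par (lab x) = lab y \<or> 1 \<le> lab y \<and> par (lab y) = lab x)"
    if xy: "(x, y) \<in> parcs H" for x y
  proof -
    have V: "x \<in> pverts H" "y \<in> pverts H" using xy H.in_arcsD1 H.in_arcsD2 by auto
    consider "x \<in> I" "y \<in> I" | "x \<in> I" "y \<notin> I" | "x \<notin> I" "y \<in> I" | "x \<notin> I" "y \<notin> I" by blast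
    then show ?thesis
    proof cases
      case 1
      then show ?thesis using IH xy by blast
    next
      case 2
      then show ?thesis using sym xy V by (auto simp: J_def sends_def)
    next
      case 3
      then show ?thesis using xy V by (auto simp: J_def sends_def)
    next
      case 4
      then have F': "(x, y) \<in> arcs F" "(y, x) \<in> arcs F" using xy V sym by (auto simp: F)
      have "x \<in> J \<or> x \<in> L" "y \<in> J \<or> y \<in> L" using 4 V by (auto simp: L_def)
      then consider "x \<in> J" "y \<in> J" | "x \<in> J" "y \<in> L" | "x \<in> L" "y \<in> J" | "x \<in> L" "y \<in> L" by blast
      then show ?thesis
      proof cases
        case 1
        then show ?thesis using JJ xy by blast
      next
        case 2
        then show ?thesis using att[of x y] F' by blast
      next
        case 3
        then show ?thesis using att[of y x] F' by blast
      next
        case 4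
        then have "1 \<le> lab x" "1 \<le> lab y" using lab(2) by auto
        then show ?thesis using lab(4) F'(1) 4 by blast
      qed
    qed
  qed
  show thesis
    using IH(1) lab(2) lab(3)
    by (intro that[of I J L lab "card L" att par] arcs attJ lab(1)) (auto simp: J_def L_def)
qed

lemma subgraph_if_embedding:
  assumes "pair_graph H" "pair_graph G"
    and g: "inj_on g (pverts H)" "g ` pverts H \<subseteq> pverts G"
      "\<And>x y. (x, y) \<in> parcs H \<Longrightarrow> (g x, g y) \<in> parcs G"
  shows "\<not> subgraph_free H G"
proof -
  interpret H: pair_graph H by fact
  interpret G: pair_graph G by fact
  define h where "h = \<lparr>iso_verts = g, iso_arcs = map_prod g g, iso_head = snd, iso_tail = fst\<rparr>"
  have sub: "parcs H \<subseteq> pverts H \<times> pverts H" using H.in_arcsD1 H.in_arcsD2 by auto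
  have wf: "wf_digraph (with_proj H)" by unfold_locales
  have iso: "pre_digraph.digraph_isomorphism (with_proj H) h"
    unfolding pre_digraph.digraph_isomorphism_def
    using wf g(1) inj_on_subset[OF map_prod_inj_on[OF g(1) g(1)] sub] by (simp add: h_def)
  let ?K = "app_iso h (with_proj H)"
  have "wf_digraph ?K" using wf_digraph.wf_digraphI_app_iso[OF wf iso] .
  moreover have "wf_digraph (with_proj G)" by unfold_locales
  ultimately have "subgraph ?K (with_proj G)"
    using g by (auto simp: subgraph_def compatible_def h_def)
  moreover have "digraph_iso (with_proj H) ?K" using iso by (auto simp: digraph_iso_def)
  ultimately show ?thesis by (auto simp: subgraph_free_def)
qed

section \<open>The chromatic threshold\<close>

text \<open>Count arcs leaving a set \<open>A\<close> of about q^k n vertices of \<open>U\<close>.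
  The minimum degree gives at least (1/3 + 3e) q n |A| arcs. Those within \<open>A\<close> and those
  to vertices with few neighbours in \<open>U\<close> number at most (e/3) q n |A| each; upper
  uniformity bounds the rest by q |A| (|X| + (e/3) n).\<close>

lemma sparse_expansion:
  fixes G \<Gamma> :: "nat pair_pre_digraph" and e q :: real
  defines "N \<equiv> \<lambda>v. {w. (v, w) \<in> parcs G}"
  assumes unif: "upper_uniform (e / 3) q n \<Gamma>"
    and G: "pair_graph G" "pverts G = {..<n}" "parcs G \<subseteq> parcs \<Gamma>"
    and deg: "\<And>v. v < n \<Longrightarrow> (1/3 + 3 * e) * q * n \<le> card (N v)"
    and q: "0 < q" "q \<le> 1" "2 * q \<le> e / 3" "1 \<le> q ^ 15 * n" and e: "0 < e"
    and U: "U \<subseteq> {..<n}" "2 \<le> k" "k \<le> 15" "q ^ k * n \<le> card U"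
  shows "(1/3 + 2 * e) * n \<le> card {x \<in> {..<n}. q ^ (k + 2) * n \<le> card (N x \<inter> U)}"
proof -
  interpret G: pair_graph G by fact
  have NV: "N v \<subseteq> {..<n}" for v using G.in_arcsD2 G(2) by (auto simp: N_def)
  have Nsym: "u \<in> N v \<longleftrightarrow> v \<in> N u" for u v using G.arcs_symmetric by (auto simp: N_def)
  \<comment> \<open>Shrinking \<open>U\<close> to between q^k n and 2 q^k n vertices makes the at
    most |A|^2 arcs inside \<open>A\<close> negligible; this uses k >= 2 and 2q <= e/3.\<close>
  define m where "m = nat \<lceil>q ^ k * n\<rceil>"
  have qk: "q ^ 15 * n \<le> q ^ k * n" using q U by (intro mult_right_mono power_decreasing) auto
  have "m \<le> card U" using U(4) by (simp add: m_def ceiling_le_iff nat_le_iff)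
  then obtain A where A: "A \<subseteq> U" "card A = m" by (meson obtain_subset_with_card_n)
  have A1: "q ^ k * n \<le> card A" unfolding A(2) m_def by linarith
  have A2: "card A \<le> 2 * (q ^ k * n)"
    unfolding A(2) m_def using q(4) qk by linarith
  have Apos: "0 < real (card A)" using A1 q(4) qk by linarith
  have AV: "A \<subseteq> {..<n}" using A U by auto
  have finA: "finite A" using AV finite_subset by blast
  define X where "X = {x \<in> {..<n}. q ^ (k + 2) * n \<le> card (N x \<inter> U)}"
  have "(\<Sum>u\<in>A. card (N u)) = (\<Sum>u\<in>A. \<Sum>x\<in>{x \<in> {..<n}. x \<in> N u}. 1)"
    using NV by (intro sum.cong refl) (auto intro!: arg_cong[where f = card])
  also have "\<dots> = (\<Sum>x<n. \<Sum>u\<in>{u \<in> A. x \<in> N u}. 1)"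
    using finA by (intro sum.swap_restrict) auto
  also have "\<dots> = (\<Sum>x<n. card (N x \<inter> A))"
    using Nsym by (intro sum.cong refl) (auto intro!: arg_cong[where f = card])
  also have "{..<n} = (X - A) \<union> (A \<union> ({..<n} - X - A))" using AV by (auto simp: X_def)
  also have "(\<Sum>x\<in>(X - A) \<union> (A \<union> ({..<n} - X - A)). card (N x \<inter> A)) =
      (\<Sum>x\<in>X - A. card (N x \<inter> A)) + ((\<Sum>x\<in>A. card (N x \<inter> A)) + (\<Sum>x\<in>{..<n} - X - A. card (N x \<inter> A)))"
    using finA by (subst sum.union_disjoint; (subst sum.union_disjoint)?) (auto simp: X_def)
  finally have split: "(\<Sum>u\<in>A. card (N u)) = (\<Sum>x\<in>X - A. card (N x \<inter> A)) +
      ((\<Sum>x\<in>A. card (N x \<inter> A)) + (\<Sum>x\<in>{..<n} - X - A. card (N x \<inter> A)))" .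
  have "card A * ((1/3 + 3 * e) * q * n) = (\<Sum>u\<in>A. (1/3 + 3 * e) * q * n)" by simp
  also have "\<dots> \<le> (\<Sum>u\<in>A. real (card (N u)))" using deg AV by (intro sum_mono) auto
  finally have 0: "card A * ((1/3 + 3 * e) * q * n) \<le> real (\<Sum>u\<in>A. card (N u))" by simp
  have 1: "real (\<Sum>x\<in>X - A. card (N x \<inter> A)) \<le> q * card A * (card X + e / 3 * n)"
  proof -
    have "(\<Sum>x\<in>X - A. card (N x \<inter> A)) = card (SIGMA x:X - A. N x \<inter> A)"
      using finA by (subst card_SigmaI) (auto simp: X_def)
    also have "\<dots> \<le> card (parcs \<Gamma> \<inter> A \<times> (X - A))"
    proof (rule card_inj_on_le[where f = prod.swap])
      show "finite (parcs \<Gamma> \<inter> A \<times> (X - A))" using finA by (auto simp: X_def)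
      show "prod.swap ` (SIGMA x:X - A. N x \<inter> A) \<subseteq> parcs \<Gamma> \<inter> A \<times> (X - A)"
        using G(3) G.arcs_symmetric by (auto simp: N_def)
    qed simp
    finally have "real (\<Sum>x\<in>X - A. card (N x \<inter> A)) \<le> real (card (parcs \<Gamma> \<inter> A \<times> (X - A)))"
      by (rule of_nat_mono)
    also have "\<dots> \<le> q * card A * (card (X - A) + e / 3 * n)"
    proof -
      have "X - A \<subseteq> {..<n}" "A \<inter> (X - A) = {}" "q ^ 15 * n \<le> card A"
        using A1 qk by (auto simp: X_def)
      then show ?thesis using unif AV unfolding upper_uniform_def by blast
    qed
    also have "\<dots> \<le> q * card A * (card X + e / 3 * n)"
    proof -
      have "card (X - A) \<le> card X" by (intro card_mono) (auto simp: X_def)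
      then show ?thesis using q by (intro mult_left_mono) auto
    qed
    finally show ?thesis .
  qed
  have 2: "real (\<Sum>x\<in>A. card (N x \<inter> A)) \<le> q * card A * (e / 3 * n)"
  proof -
    have "(\<Sum>x\<in>A. card (N x \<inter> A)) \<le> (\<Sum>x\<in>A. card A)"
      using finA by (intro sum_mono card_mono) auto
    then have "real (\<Sum>x\<in>A. card (N x \<inter> A)) \<le> real (\<Sum>x\<in>A. card A)" by (rule of_nat_mono)
    also have "\<dots> = card A * real (card A)" by simp
    also have "\<dots> \<le> card A * (q * (e / 3 * n))"
    proof (rule mult_left_mono)
      have "q ^ k \<le> q ^ 2" using q U by (intro power_decreasing) auto
      then have "2 * (q ^ k * n) \<le> 2 * (q ^ 2 * n)" by (simp add: mult_right_mono)
      also have "\<dots> = q * n * (2 * q)" by (simp add: power2_eq_square)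
      also have "\<dots> \<le> q * n * (e / 3)" using q by (intro mult_left_mono) auto
      finally show "real (card A) \<le> q * (e / 3 * n)" using A2 by (simp add: mult_ac)
    qed simp
    finally show ?thesis by (simp add: mult_ac)
  qed
  have 3: "real (\<Sum>x\<in>{..<n} - X - A. card (N x \<inter> A)) \<le> q * card A * (e / 3 * n)"
  proof -
    have "real (\<Sum>x\<in>{..<n} - X - A. card (N x \<inter> A)) = (\<Sum>x\<in>{..<n} - X - A. real (card (N x \<inter> A)))" by simp
    also have "\<dots> \<le> (\<Sum>x\<in>{..<n} - X - A. q ^ (k + 2) * n)"
    proof (rule sum_mono)
      fix x assume "x \<in> {..<n} - X - A"
      then have "real (card (N x \<inter> U)) < q ^ (k + 2) * n" by (auto simp: X_def)
      moreover have "card (N x \<inter> A) \<le> card (N x \<inter> U)"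
        using A(1) U(1) by (intro card_mono) (auto intro: finite_subset)
      ultimately show "real (card (N x \<inter> A)) \<le> q ^ (k + 2) * n" by linarith
    qed
    also have "\<dots> = card ({..<n} - X - A) * (q ^ (k + 2) * n)" by simp
    also have "\<dots> \<le> n * (q ^ (k + 2) * n)"
    proof -
      have "card ({..<n} - X - A) \<le> card {..<n}" by (intro card_mono) auto
      then show ?thesis using q by (intro mult_right_mono) auto
    qed
    also have "\<dots> = (q ^ k * n) * (q * n) * q" by (simp add: power_add power2_eq_square)
    also have "\<dots> \<le> card A * (q * n) * (e / 3)"
      using A1 q by (intro mult_mono) auto
    finally show ?thesis by (simp add: mult_ac)
  qed
  have "real (\<Sum>u\<in>A. card (N u)) = real (\<Sum>x\<in>X - A. card (N x \<inter> A)) +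
      (real (\<Sum>x\<in>A. card (N x \<inter> A)) + real (\<Sum>x\<in>{..<n} - X - A. card (N x \<inter> A)))"
    unfolding split by simp
  then have "card A * ((1/3 + 3 * e) * q * n) \<le> q * card A * (card X + e / 3 * n) +
      (q * card A * (e / 3 * n) + q * card A * (e / 3 * n))"
    using 0 1 2 3 by linarith
  also have "\<dots> = (q * card A) * (card X + e * n)" by (simp add: algebra_simps)
  finally have "(q * card A) * ((1/3 + 3 * e) * n) \<le> (q * card A) * (card X + e * n)"
    by (simp add: mult_ac)
  then have "(1/3 + 3 * e) * n \<le> card X + e * n"
    using q(1) Apos by simp
  then show ?thesis unfolding X_def by (simp add: algebra_simps)
qed

text \<open>The deterministic core: the heavy edges \<open>M\<close> are D-degenerate and take
  \<open>D\<close> colours, the other edges take 2, and the product colouring is proper.\<close>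

lemma chromatic_number_le:
  fixes H :: "'a pair_pre_digraph" and G \<Gamma> :: "nat pair_pre_digraph" and e q :: real and D :: nat
  assumes H: "pair_graph H" "pverts H = I \<union> J \<union> L" "I \<inter> J = {}" "I \<inter> L = {}" "J \<inter> L = {}"
      "inj_on lab L" "lab ` L \<subseteq> {..t}" "att ` J \<subseteq> {..t}"
    and par: "\<And>i. 1 \<le> i \<Longrightarrow> i \<le> t \<Longrightarrow> par i < i"
    and arcs: "\<And>x y. (x, y) \<in> parcs H \<Longrightarrow> x \<in> I \<and> y \<in> J \<or> x \<in> J \<and> y \<in> I \<or>
      x \<in> J \<and> y \<in> L \<and> att x = lab y \<or> x \<in> L \<and> y \<in> J \<and> att y = lab x \<or>
      x \<in> L \<and> y \<in> L \<and> (1 \<le> lab x \<and> par (lab x) = lab y \<or> 1 \<le> lab y \<and> par (lab y) = lab x)"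
    and unif: "upper_uniform (e / 3) q n \<Gamma>"
    and G: "pair_graph G" "pverts G = {..<n}" "parcs G \<subseteq> parcs \<Gamma>" "subgraph_free H G"
    and deg: "\<And>v. v < n \<Longrightarrow> (1/3 + 3 * e) * q * n \<le> card {w. (v, w) \<in> parcs G}"
    and e: "0 < e" "e \<le> 1" and D: "8 * (real t + 1) / e \<le> D"
    and q: "0 < q" "q \<le> 1/3" "2 * q \<le> e / 3" "1 \<le> q ^ 15 * n"
    and few: "2 * D < e * (q ^ 5 * n)"
    and tuple: "2 * (real t + 1 + card J) \<le> q ^ 17 * n"
      "real t + 1 + card J + card I \<le> e / 2 * (e / 8) ^ t * n * (q ^ 17 / 2) ^ card J"
  shows "chromatic_number G \<le> 2 * D"
proof -
  interpret H: pair_graph H by fact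
  interpret G: pair_graph G by fact
  have n: "0 < n" using q(4) by (cases n) auto
  define V where "V = {..<n}"
  have V: "finite V" "V \<noteq> {}" "card V = n" using n by (auto simp: V_def)
  define N where "N v = {w. (v, w) \<in> parcs G}" for v
  have NV: "N v \<subseteq> V" for v using G.in_arcsD2 G(2) by (auto simp: N_def V_def)
  have Nsym: "u \<in> N v \<longleftrightarrow> v \<in> N u" for u v using G.arcs_symmetric by (auto simp: N_def)
  have Nirr: "v \<notin> N v" for v using G.no_loops' by (auto simp: N_def)
  define S where "S v = {w \<in> V. q ^ 17 * card V \<le> card (N w \<inter> N v)}" for v
  define M where "M v = {u \<in> N v. e * card V \<le> card {x \<in> V. x \<in> S u \<and> x \<in> S v}}" for v
  have Msym: "u \<in> M v \<longleftrightarrow> v \<in> M u" for u v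
    using Nsym[of u v] unfolding M_def by (simp add: conj_commute)
  have Mirr: "v \<notin> M v" for v using Nirr by (simp add: M_def)
  have MN: "M v \<subseteq> N v" for v by (auto simp: M_def)
  have finH: "finite I" "finite J" using H.pair_finite_verts unfolding H(2) by auto
  have degenerate: "\<exists>v\<in>W. card (M v \<inter> W) < D" if W: "W \<subseteq> V" "W \<noteq> {}" for W
  proof (rule ccontr)
    assume "\<not> ?thesis"
    then have large: "D \<le> card (M v \<inter> W)" if "v \<in> W" for v using that by (auto simp: not_less)
    have "\<exists>f. inj_on f {..t} \<and> f ` {..t} \<subseteq> W \<and> (\<forall>i. 1 \<le> i \<and> i \<le> t \<longrightarrow> f i \<in> M (f (par i))) \<and>
        e / 2 * (e / 8) ^ t * card V \<le> card {x \<in> V. \<forall>i\<le>t. x \<in> S (f i)}"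
    proof (rule tree_with_common_points)
      show "finite W" using W V finite_subset by blast
      show "8 * (real t + 1) / e \<le> card (M v \<inter> W)" if "v \<in> W" for v
        using large[OF that] D by linarith
      show "e * card V \<le> card {x \<in> V. x \<in> S u \<and> x \<in> S v}" if "u \<in> M v" for u v
        using that by (simp add: M_def)
    qed (use W V e Msym Mirr par in auto)
    then obtain f where f: "inj_on f {..t}" "f ` {..t} \<subseteq> W"
        "\<forall>i. 1 \<le> i \<and> i \<le> t \<longrightarrow> f i \<in> M (f (par i))"
        "e / 2 * (e / 8) ^ t * card V \<le> card {x \<in> V. \<forall>i\<le>t. x \<in> S (f i)}" by blast
    \<comment> \<open>Every point of \<open>Z\<close> has at least q^17 n common neighbours with
      every tree vertex, which are the candidates for the leaves; \<open>Z\<close> itself supplies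
      the cloud.\<close>
    define Z where "Z = {x \<in> V. \<forall>i\<le>t. x \<in> S (f i)}"
    have Z0: "0 < e / 2 * (e / 8) ^ t * card V" using e n V by simp
    have "\<exists>g. inj_on g (I \<union> J \<union> L) \<and> g ` (I \<union> J \<union> L) \<subseteq> V \<and> (\<forall>(x, y)\<in>parcs H. g y \<in> N (g x))"
    proof (rule embed_cloud_forest[OF finH H(3-8) arcs])
      show "Z \<subseteq> V" by (auto simp: Z_def)
      have "0 < real (card Z)" using f(4) Z0 unfolding Z_def by linarith
      then show "Z \<noteq> {}" by auto
      show "q ^ 17 * n \<le> card (N w \<inter> N (f i))" if "w \<in> Z" "i \<le> t" for w i
        using that V by (auto simp: Z_def S_def)
      show "real t + 1 + card J + card I \<le> card Z * ((q ^ 17 * n) / (2 * card V)) ^ card J"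
      proof -
        have eq: "(q ^ 17 * n) / (2 * card V) = q ^ 17 / 2" using n V by simp
        have "e / 2 * (e / 8) ^ t * n * (q ^ 17 / 2) ^ card J \<le> card Z * (q ^ 17 / 2) ^ card J"
          using f(4) V q by (intro mult_right_mono) (auto simp: Z_def)
        then show ?thesis unfolding eq using tuple(2) by linarith
      qed
      show "f i \<in> N (f (par i))" if "1 \<le> i" "i \<le> t" for i using f(3) MN that by blast
      show "f ` {..t} \<subseteq> V" using f(2) W(1) by blast
    qed (use V Nsym NV f(1) tuple(1) in auto)
    then obtain g where g: "inj_on g (pverts H)" "g ` pverts H \<subseteq> V"
        "\<forall>(x, y)\<in>parcs H. g y \<in> N (g x)" unfolding H(2) by blast
    have "\<not> subgraph_free H G"
      using g by (intro subgraph_if_embedding[OF H(1) G(1)]) (auto simp: N_def V_def G(2))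
    then show False using G(4) by simp
  qed
  obtain c where c: "\<forall>v\<in>V. c v < D" "\<forall>u\<in>V. \<forall>v\<in>V. u \<in> M v \<longrightarrow> c u \<noteq> (c v :: nat)"
    using degenerate_coloring[OF V(1) Msym Mirr degenerate] by blast
  have "\<exists>c. (\<forall>v\<in>V. c v < 2) \<and> (\<forall>u\<in>V. \<forall>v\<in>V. u \<in> N v - M v \<longrightarrow> c u \<noteq> (c v :: nat))"
  proof (rule bipartite_remainder[OF V(1) e(1)])
    show "(1/3 + 2 * e) * card V \<le> card {x \<in> V. q ^ (k + 2) * card V \<le> card (N x \<inter> U)}"
      if "U \<subseteq> V" "2 \<le> k" "k \<le> 15" "q ^ k * card V \<le> card U" for U k
      using sparse_expansion[OF unif G(1-3) deg q(1) _ q(3,4) e(1)] that q(2) V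
      by (simp add: V_def N_def)
    show "q ^ 2 * card V \<le> card (N v)" if "v \<in> V" for v
    proof -
      have "q * (q * n) \<le> (1/3 + 3 * e) * (q * n)" using q e by (intro mult_right_mono) auto
      then show ?thesis using deg[of v] that V by (simp add: V_def N_def power2_eq_square mult_ac)
    qed
    show "card ({w \<in> V. q ^ 17 * card V \<le> card (N w \<inter> N u)} \<inter> {w \<in> V. q ^ 17 * card V \<le> card (N w \<inter> N v)})
        < e * card V" if "u \<in> N v" "u \<notin> M v" for u v
    proof -
      have "{w \<in> V. q ^ 17 * card V \<le> card (N w \<inter> N u)} \<inter> {w \<in> V. q ^ 17 * card V \<le> card (N w \<inter> N v)} =
          {x \<in> V. x \<in> S u \<and> x \<in> S v}" by (auto simp: S_def)
      then show ?thesis using that by (simp add: M_def not_le)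
    qed
    show "real (\<Sum>v\<in>V. card (M v)) < e * card V * (q ^ 5 * card V)"
    proof -
      have "M v \<inter> V = M v" for v using MN[of v] NV[of v] by blast
      then have "(\<Sum>v\<in>V. card (M v)) \<le> 2 * D * n"
        using degenerate_sum_degrees[OF V(1) Msym Mirr degenerate] V by simp
      then have "real (\<Sum>v\<in>V. card (M v)) \<le> real (2 * D * n)" by (rule of_nat_mono)
      also have "\<dots> = (2 * D) * real n" by simp
      also have "\<dots> < e * (q ^ 5 * n) * n" using few n by (intro mult_strict_right_mono) auto
      finally show ?thesis using V by (simp add: mult_ac)
    qed
    show "u \<in> N v \<longleftrightarrow> v \<in> N u" "u \<in> M v \<longleftrightarrow> v \<in> M u" for u v by (rule Nsym, rule Msym)
  qed (use q e NV MN in auto)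
  then obtain c' where c': "\<forall>v\<in>V. c' v < 2" "\<forall>u\<in>V. \<forall>v\<in>V. u \<in> N v - M v \<longrightarrow> c' u \<noteq> (c' v :: nat)"
    by blast
  \<comment> \<open>The pair of colours is encoded as a number with last binary digit
    \<open>c'\<close>.\<close>
  have "proper_coloring G (2 * D) (\<lambda>v. 2 * c v + c' v)"
    unfolding proper_coloring_def
  proof (intro conjI ballI, goal_cases)
    case (1 v)
    then have "c v < D" "c' v < 2" using c c' G(2) by (auto simp: V_def)
    then show ?case by linarith
  next
    case (2 a)
    obtain u v where a: "a = (u, v)" by (cases a)
    have uv: "u \<in> V" "v \<in> V" "v \<in> N u"
      using 2 a G.in_arcsD1 G.in_arcsD2 G(2) by (auto simp: V_def N_def)
    have "c' u < 2" "c' v < 2" using c' uv by auto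
    have "2 * c u + c' u \<noteq> 2 * c v + c' v"
    proof
      assume eq: "2 * c u + c' u = 2 * c v + c' v"
      then have "c u = c v" using \<open>c' u < 2\<close> \<open>c' v < 2\<close> by presburger
      moreover have "c' u = c' v" using eq calculation by simp
      ultimately show False using c(2) c'(2) uv by (metis DiffI)
    qed
    then show ?case using a by simp
  qed
  then show ?thesis unfolding chromatic_number_def by (intro Least_le) blast
qed

theorem proposition4p1:
  fixes H :: "'a pair_pre_digraph" and p :: "nat \<Rightarrow> real"
  assumes "pair_graph H"
    and "cloud_forest H"
    and "\<And>n. 0 \<le> p n \<and> p n \<le> 1"
    and "p \<longlonglongrightarrow> 0"
    and "n_to_minus_o1 p"
  shows "delta_chi H p \<le> ereal (1 / 3)"
proof -
  obtain I J L :: "'a set" and lab att par :: "_ \<Rightarrow> nat" and t where H: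
    "pverts H = I \<union> J \<union> L" "I \<inter> J = {}" "I \<inter> L = {}" "J \<inter> L = {}"
    "inj_on lab L" "lab ` L \<subseteq> {..t}" "att ` J \<subseteq> {..t}"
    "\<And>i. 1 \<le> i \<Longrightarrow> i \<le> t \<Longrightarrow> par i < i"
    "\<And>x y. (x, y) \<in> parcs H \<Longrightarrow> x \<in> I \<and> y \<in> J \<or> x \<in> J \<and> y \<in> I \<or>
      x \<in> J \<and> y \<in> L \<and> att x = lab y \<or> x \<in> L \<and> y \<in> J \<and> att y = lab x \<or>
      x \<in> L \<and> y \<in> L \<and> (1 \<le> lab x \<and> par (lab x) = lab y \<or> 1 \<le> lab y \<and> par (lab y) = lab x)"
    by (rule cloud_forest_structure[OF assms(1,2)]) (rule that; assumption)
  have bound: "delta_chi H p \<le> ereal (1/3 + 3 * e)" if e: "0 < e" "e \<le> 1" for e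
  proof -
    \<comment> \<open>The degree needed to grow the tree; it depends only on \<open>t\<close> and
      \<open>e\<close>, so 2D is a bound on the chromatic number uniform in n.\<close>
    define D where "D = nat \<lceil>8 * (real t + 1) / e\<rceil>"
    have D: "8 * (real t + 1) / e \<le> D" unfolding D_def by linarith
    have "0 < 8 * (real t + 1) / e" using e by simp
    then have D0: "0 < D" using D by linarith
    have large: "\<forall>\<^sub>F n in sequentially. C \<le> p n ^ k * real n" for k C
      using power_times_nat_at_top[OF assms(5), of k] assms(3) by (simp add: filterlim_at_top)
    \<comment> \<open>Chosen so that p^(17 |J|) n >= C leaves enough common neighbours of the leaf
      images to hold the whole cloud.\<close>
    define C where "C = (real t + 1 + card J + card I) / (e / 2 * (e / 8) ^ t / 2 ^ card J)"
    have "\<forall>\<^sub>F n in sequentially. p n < min (1/3) (e / 6)"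
      using assms(4) by (rule order_tendstoD) (use e in auto)
    moreover have "\<forall>\<^sub>F n in sequentially. p n > 0"
      using assms(5) by (simp add: n_to_minus_o1_def)
    ultimately have "\<forall>\<^sub>F n in sequentially. \<forall>\<Gamma>. upper_uniform (e / 3) (p n) n \<Gamma> \<longrightarrow>
      (\<forall>G. pair_graph G \<and> spanning (with_proj G) (with_proj \<Gamma>) \<and> subgraph_free H G \<and>
        (1/3 + 3 * e) * p n * real n \<le> real (min_degree G) \<longrightarrow>
        real (chromatic_number G) \<le> real (2 * D))"
      using large[of 1 15] large[of "2 * (real t + 1 + card J)" 17] large[of "2 * D / e + 1" 5]
        large[of C "17 * card J"]
    proof eventually_elim
      case (elim n)
      show ?case
      proof (intro allI impI, elim conjE)
        fix \<Gamma> G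
        assume unif: "upper_uniform (e / 3) (p n) n \<Gamma>" and G: "pair_graph G"
          "spanning (with_proj G) (with_proj \<Gamma>)" "subgraph_free H G"
          and deg: "(1/3 + 3 * e) * p n * real n \<le> real (min_degree G)"
        have V: "pverts G = {..<n}" and sub: "parcs G \<subseteq> parcs \<Gamma>"
          using G(2) unif by (auto simp: spanning_def subgraph_def upper_uniform_def)
        have "(1/3 + 3 * e) * p n * n \<le> card {w. (v, w) \<in> parcs G}" if "v < n" for v
        proof -
          have "min_degree G \<le> out_degree G v"
            unfolding min_degree_def using that V by (intro Min_le) auto
          also have "\<dots> = card ((\<lambda>w. (v, w)) ` {w. (v, w) \<in> parcs G})"
            unfolding out_degree_def by (intro arg_cong[where f = card]) (auto simp: out_arcs_def)
          also have "\<dots> = card {w. (v, w) \<in> parcs G}"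
            by (intro card_image) (auto simp: inj_on_def)
          finally show ?thesis using deg by linarith
        qed
        moreover have "2 * D < e * (p n ^ 5 * n)"
        proof -
          \<comment> \<open>The summand 1 in the corresponding instance of \<open>large\<close>
            makes the inequality strict.\<close>
          have "2 * D / e < p n ^ 5 * n" using elim by linarith
          then show ?thesis using e by (simp add: field_simps)
        qed
        moreover have "real t + 1 + card J + card I \<le> e / 2 * (e / 8) ^ t * n * (p n ^ 17 / 2) ^ card J"
        proof -
          have "0 < e / 2 * (e / 8) ^ t / 2 ^ card J" using e by simp
          then have "real t + 1 + card J + card I \<le> (e / 2 * (e / 8) ^ t / 2 ^ card J) * (p n ^ (17 * card J) * n)"
            using elim(6) unfolding C_def by (simp only: pos_divide_le_eq mult.commute)
          then show ?thesis by (simp add: power_divide mult_ac flip: power_mult)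
        qed
        ultimately have "chromatic_number G \<le> 2 * D"
          using elim e D
          by (intro chromatic_number_le[OF assms(1) H unif G(1) V sub G(3)]) auto
        then show "real (chromatic_number G) \<le> real (2 * D)" by (rule of_nat_mono)
      qed
    qed
    then have "with_high_probability (\<lambda>n. binomial_random_graph n (p n))
       (\<lambda>n \<Gamma>. \<forall>G. pair_graph G \<and> spanning (with_proj G) (with_proj \<Gamma>) \<and> subgraph_free H G \<and>
          (1/3 + 3 * e) * p n * real n \<le> real (min_degree G) \<longrightarrow>
          real (chromatic_number G) \<le> real (2 * D))"
      using assms(3,5) e by (intro with_high_probability_mono[OF upper_uniform_whp[of p "e / 3"]]) auto
    moreover have "0 < real (2 * D)" using D0 by simp
    moreover have "0 < 1/3 + 3 * e" using e by simp
    ultimately show ?thesis unfolding delta_chi_def by (intro Inf_lower imageI CollectI conjI exI) auto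
  qed
  show ?thesis
  proof (rule ereal_le_epsilon2)
    fix x :: real assume "0 < x"
    \<comment> \<open>The minimum keeps the parameter at most 1, as \<open>bound\<close> requires,
      and three times it at most \<open>x\<close>.\<close>
    then have "delta_chi H p \<le> ereal (1/3 + 3 * min 1 (x / 3))" by (intro bound) auto
    also have "\<dots> \<le> ereal (1/3 + x)" by simp
    finally show "delta_chi H p \<le> ereal (1/3) + ereal x" by simp
  qed
qed

end
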